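(* Let $\mathcal{H}_1,\mathcal{H}_2$ be infinite-dimensional separable Hilbert spaces, let $(g_k)_{k\in K}$ be a sequence in $\mathcal{H}_1$ and $(f_i)_{i\in I}$ a sequence in $\mathcal{H}_2$. 1. If $(g_k)$ and $(f_i)$ are Bessel sequences with bounds $B$ and $B'$ respectively, then $(f_i\otimes\overline{g}_k)_{(i,k)\in I\times K}$ is a Bessel sequence for $\mathcal{HS}(\mathcal{H}_1,\mathcal{H}_2)$ with bound $\sqrt{B\cdot B'}$. 2. If $(g_k)$ and $(f_i)$ are frames (for $\mathcal{H}_1$ and $\mathcal{H}_2$) with frame bounds $A,B$ and $A',B'$ respectively, then $(f_i\otimes\overline{g}_k)_{(i,k)\in I\times K}$ is a frame for $\mathcal{HS}(\mathcal{H}_1,\mathcal{H}_2)$ with bounds $\sqrt{A\cdot A'}$ and $\sqrt{B\cdot B'}$. A dual frame is $(\tilde f_i\otimes\overline{\tilde g}_k)_{(i,k)\in I\times K}$, where $(\tilde f_i)$ and $(\tilde g_k)$ are the canonical dual frames of $(f_i)$ and $(g_k)$. 3. If $(g_k)$ and $(f_i)$ are Riesz bases (of $\mathcal{H}_1$ and $\mathcal{H}_2$), then $(f_i\otimes\overline{g}_k)_{(i,k)\in I\times K}$ is a Riesz basis for $\mathcal{HS}(\mathcal{H}_1,\mathcal{H}_2)$. The biorthogonal sequence is $(\tilde f_i\otimes\overline{\tilde g}_k)_{(i,k)\in I\times K}$, where $(\tilde f_i)$ and $(\tilde g_k)$ are the biorthogonal (canonical dual) sequences of $(f_i)$ and 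$(g_k)$.
   Context: Inner products are linear in the first argument; index sets are countable. For $f\in\mathcal{H}_2$, $g\in\mathcal{H}_1$, $f\otimes\overline{g}:\mathcal{H}_1\to\mathcal{H}_2$ is the operator $(f\otimes\overline{g})(h)=\langle h,g\rangle f$. $\mathcal{HS}(\mathcal{H}_1,\mathcal{H}_2)$ is the Hilbert space of Hilbert–Schmidt operators $\mathcal{H}_1\to\mathcal{H}_2$ with inner product $\langle S,T\rangle_{\mathcal{HS}}=\sum_n\langle Se_n,Te_n\rangle$ for any orthonormal basis $(e_n)$ of $\mathcal{H}_1$. A sequence $(x_k)$ in a Hilbert space $\mathcal{H}$ is a Bessel sequence with bound $B$ if $\sum_k|\langle x,x_k\rangle|^2\le B\|x\|^2$ for all $x\in\mathcal{H}$; it is a frame with bounds $A,B>0$ if $A\|x\|^2\le\sum_k|\langle x,x_k\rangle|^2\le B\|x\|^2$ for all $x\in\mathcal{H}$. The frame operator is $Sx=\sum_k\langle x,x_k\rangle x_k$ and the canonical dual frame is $\tilde x_k=S^{-1}x_k$. A frame $(y_k)$ is a dual frame of a frame $(x_k)$ if $x=\sum_k\langle x,y_k\rangle x_k=\sum_k\langle x,x_k\rangle y_k$ for all $x\in\mathcal{H}$. A Riesz basis is a complete sequence $(x_k)$ for which there are $A,B>0$ with $A\sum_k|c_k|^2\le\|\sum_k c_kx_k\|^2\le B\sum_k|c_k|^2$ for all finite scalar sequences $(c_k)$; sequences $(x_k)$, $(y_k)$ are biorthogonal if $\langle x_k,y_j\rangle=\delta_{kj}$. The biorthogonal sequence of a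 Riesz basis is its canonical dual frame.
   Formalization: The bounds √(BB') and √(AA') in parts 1 and 2 are replaced by BB' and AA', since with the squared-norm definitions the stated bounds are false (e.g. both sequences twice an orthonormal basis give 16, not 4). *)

theory Defs
  imports "HOL-Analysis.Analysis"
begin

section \<open>Complex Hilbert spaces\<close>

text \<open>
  The inner product is linear in its first argument. Norm, metric and topology come from
  the underlying real inner product, which is the real part of the complex one.
\<close>

class complex_inner = real_inner +
  fixes scaleC :: "complex \<Rightarrow> 'a \<Rightarrow> 'a" (infixr \<open>*\<^sub>C\<close> 75)
    and cinner :: "'a \<Rightarrow> 'a \<Rightarrow> complex"
  assumes scaleC_add_right: "c *\<^sub>C (x + y) = c *\<^sub>C x + c *\<^sub>C y"
    and scaleC_add_left: "(c + d) *\<^sub>C x = c *\<^sub>C x + d *\<^sub>C x"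
    and scaleC_scaleC [simp]: "c *\<^sub>C d *\<^sub>C x = (c * d) *\<^sub>C x"
    and scaleC_one [simp]: "1 *\<^sub>C x = x"
    and scaleR_scaleC: "r *\<^sub>R x = complex_of_real r *\<^sub>C x"
    and cinner_commute: "cinner x y = cnj (cinner y x)"
    and cinner_add_left: "cinner (x + y) z = cinner x z + cinner y z"
    and cinner_scaleC_left [simp]: "cinner (c *\<^sub>C x) y = c * cinner x y"
    and inner_eq_Re_cinner: "inner x y = Re (cinner x y)"

class chilbert_space = complex_inner + complete_space

subclass (in chilbert_space) banach ..

global_interpretation cvec: vector_space "scaleC :: complex \<Rightarrow> 'a \<Rightarrow> 'a::complex_inner"
  by unfold_locales (simp_all add: scaleC_add_right scaleC_add_left)

abbreviation cspan :: "'a::complex_inner set \<Rightarrow> 'a set"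
  where "cspan \<equiv> cvec.span"

definition infinite_dim :: "'a::complex_inner itself \<Rightarrow> bool"
  where "infinite_dim _ \<longleftrightarrow> \<not> (\<exists>B::'a set. finite B \<and> cspan B = UNIV)"

definition clinear_op :: "('a::complex_inner \<Rightarrow> 'b::complex_inner) \<Rightarrow> bool"
  where "clinear_op T \<longleftrightarrow> bounded_linear T \<and> (\<forall>c x. T (c *\<^sub>C x) = c *\<^sub>C T x)"

definition is_orthonormal :: "'a::complex_inner set \<Rightarrow> bool"
  where "is_orthonormal E \<longleftrightarrow> (\<forall>e\<in>E. \<forall>e'\<in>E. cinner e e' = (if e = e' then 1 else 0))"

definition is_onb :: "'a::complex_inner set \<Rightarrow> bool"
  where "is_onb E \<longleftrightarrow> is_orthonormal E \<and> closure (cspan E) = UNIV"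

lemma cinner_add_right: "cinner x (y + z) = cinner x y + cinner x z"
  for x :: "'a::complex_inner"
  by (metis cinner_add_left cinner_commute complex_cnj_add)

lemma cinner_scaleC_right [simp]: "cinner x (c *\<^sub>C y) = cnj c * cinner x y"
  for x :: "'a::complex_inner"
  by (metis cinner_commute cinner_scaleC_left complex_cnj_mult)

lemma cinner_zero_left [simp]: "cinner 0 x = 0" for x :: "'a::complex_inner"
  using cinner_add_left[of 0 0 x] by simp

lemma cinner_zero_right [simp]: "cinner x 0 = 0" for x :: "'a::complex_inner"
  using cinner_add_right[of x 0 0] by simp

lemma cinner_minus_left [simp]: "cinner (- x) y = - cinner x y" for x :: "'a::complex_inner"
  using cinner_add_left[of x "- x" y] by (simp add: add_eq_0_iff)

lemma cinner_diff_left: "cinner (x - y) z = cinner x z - cinner y z" for x :: "'a::complex_inner"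
  using cinner_add_left[of x "- y" z] by simp

lemma cinner_minus_right [simp]: "cinner y (- x) = - cinner y x" for x :: "'a::complex_inner"
  using cinner_add_right[of y x "- x"] by (simp add: add_eq_0_iff)

lemma cinner_diff_right: "cinner z (x - y) = cinner z x - cinner z y" for x :: "'a::complex_inner"
  using cinner_add_right[of z x "- y"] by simp

lemma cinner_sum_left: "cinner (sum f A) y = (\<Sum>i\<in>A. cinner (f i) y)"
  for y :: "'a::complex_inner"
  by (induction A rule: infinite_finite_induct) (simp_all add: cinner_add_left)

lemma cinner_sum_right: "cinner y (sum f A) = (\<Sum>i\<in>A. cinner y (f i))"
  for y :: "'a::complex_inner"
  by (induction A rule: infinite_finite_induct) (simp_all add: cinner_add_right)

lemma cinner_self: "cinner x x = complex_of_real ((norm x)\<^sup>2)" for x :: "'a::complex_inner"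
proof (rule complex_eqI)
  show "Im (cinner x x) = Im (complex_of_real ((norm x)\<^sup>2))"
    using arg_cong[OF cinner_commute[of x x], of Im] by simp
  show "Re (cinner x x) = Re (complex_of_real ((norm x)\<^sup>2))"
    by (simp add: inner_eq_Re_cinner[symmetric] power2_norm_eq_inner)
qed

lemma norm_scaleC [simp]: "norm (c *\<^sub>C x) = cmod c * norm x" for x :: "'a::complex_inner"
proof -
  have "complex_of_real ((norm (c *\<^sub>C x))\<^sup>2) = complex_of_real ((cmod c * norm x)\<^sup>2)"
    unfolding cinner_self[symmetric] power_mult_distrib of_real_mult complex_norm_square
    by simp
  then have "(norm (c *\<^sub>C x))\<^sup>2 = (cmod c * norm x)\<^sup>2" using of_real_eq_iff by blast
  then show ?thesis by (simp add: power2_eq_iff_nonneg)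
qed

lemma cinner_Cauchy_Schwarz: "cmod (cinner x y) \<le> norm x * norm y" for x :: "'a::complex_inner"
proof (cases "cinner x y = 0")
  case False
  define c where "c = cnj (cinner x y) / cmod (cinner x y)"
  have c: "cmod c = 1" using False by (simp add: c_def norm_divide)
  have "c * cinner x y = cmod (cinner x y)"
    using False by (simp add: c_def complex_norm_square[symmetric] power2_eq_square mult.commute)
  then have "cmod (cinner x y) = inner (c *\<^sub>C x) y"
    by (simp add: inner_eq_Re_cinner)
  also have "\<dots> \<le> norm (c *\<^sub>C x) * norm y" by (rule norm_cauchy_schwarz)
  finally show ?thesis using c by simp
qed simp

lemma bounded_bilinear_cinner: "bounded_bilinear (cinner :: 'a::complex_inner \<Rightarrow> _)"
  by unfold_locales
    (auto simp: cinner_add_left cinner_add_right scaleR_scaleC[where 'a='a] scaleR_conv_of_real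
      intro!: exI[of _ 1] cinner_Cauchy_Schwarz)

lemma bounded_bilinear_scaleC: "bounded_bilinear (scaleC :: _ \<Rightarrow> 'a::complex_inner \<Rightarrow> _)"
  by unfold_locales
    (auto simp: scaleC_add_left scaleC_add_right scaleR_scaleC[where 'a='a] scaleR_conv_of_real
      mult.commute intro!: exI[of _ 1])

lemmas bounded_linear_cinner_left = bounded_bilinear.bounded_linear_left[OF bounded_bilinear_cinner]
lemmas bounded_linear_cinner_right = bounded_bilinear.bounded_linear_right[OF bounded_bilinear_cinner]
lemmas bounded_linear_scaleC_right = bounded_bilinear.bounded_linear_right[OF bounded_bilinear_scaleC]

subsection \<open>Orthonormal expansions\<close>

lemma norm_sum_orthonormal:
  fixes F :: "'a::complex_inner set"
  assumes "is_orthonormal F" "finite F"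
  shows "(norm (\<Sum>e\<in>F. a e *\<^sub>C e))\<^sup>2 = (\<Sum>e\<in>F. (cmod (a e))\<^sup>2)"
proof -
  have "complex_of_real ((norm (\<Sum>e\<in>F. a e *\<^sub>C e))\<^sup>2) = (\<Sum>e\<in>F. \<Sum>e'\<in>F. a e * (cnj (a e') * cinner e e'))"
    unfolding cinner_self[symmetric]
    by (simp add: cinner_sum_left cinner_sum_right sum_distrib_left mult.left_commute)
       (rule sum.swap)
  also have "\<dots> = (\<Sum>e\<in>F. \<Sum>e'\<in>F. if e = e' then a e * cnj (a e) else 0)"
    using assms(1) by (intro sum.cong refl) (auto simp: is_orthonormal_def)
  also have "\<dots> = complex_of_real (\<Sum>e\<in>F. (cmod (a e))\<^sup>2)"
    using assms(2) by (simp add: complex_norm_square del: of_real_power)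
  finally show ?thesis using of_real_eq_iff by blast
qed

lemma orthonormal_mono: "is_orthonormal E \<Longrightarrow> F \<subseteq> E \<Longrightarrow> is_orthonormal F"
  unfolding is_orthonormal_def by (meson subsetD)

lemma Bessel_finite:
  fixes F :: "'a::complex_inner set"
  assumes "is_orthonormal F" "finite F"
  shows "(\<Sum>e\<in>F. (cmod (cinner x e))\<^sup>2) \<le> (norm x)\<^sup>2"
proof -
  define p where "p = (\<Sum>e\<in>F. cinner x e *\<^sub>C e)"
  have np: "(norm p)\<^sup>2 = (\<Sum>e\<in>F. (cmod (cinner x e))\<^sup>2)"
    unfolding p_def by (rule norm_sum_orthonormal[OF assms])
  have "cinner x p = (\<Sum>e\<in>F. cnj (cinner x e) * cinner x e)"
    by (simp add: p_def cinner_sum_right)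
  also have "\<dots> = complex_of_real ((norm p)\<^sup>2)"
    by (simp add: np complex_norm_square mult.commute del: of_real_power)
  finally have "inner x p = (norm p)\<^sup>2" by (simp add: inner_eq_Re_cinner)
  then have "norm p * norm p \<le> norm x * norm p"
    using norm_cauchy_schwarz[of x p] by (simp add: power2_eq_square)
  then have "norm p \<le> norm x"
    by (cases "p = 0") simp_all
  then show ?thesis
    by (simp add: np[symmetric] power_mono)
qed

lemma Bessel_summable:
  fixes E :: "'a::complex_inner set"
  assumes "is_orthonormal E"
  shows "(\<lambda>e. (cmod (cinner x e))\<^sup>2) summable_on E"
  by (rule nonneg_bdd_above_summable_on)
     (use assms in \<open>auto intro!: bdd_aboveI2[of _ _ "(norm x)\<^sup>2"] Bessel_finite dest: orthonormal_mono\<close>)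

lemma orthonormal_summable:
  fixes E :: "'a::chilbert_space set"
  assumes E: "is_orthonormal E" and s: "(\<lambda>e. (cmod (a e))\<^sup>2) summable_on E"
  shows "(\<lambda>e. a e *\<^sub>C e) summable_on E"
proof -
  define S where "S = infsum (\<lambda>e. (cmod (a e))\<^sup>2) E"
  have "\<exists>P. eventually P (finite_subsets_at_top E) \<and>
          (\<forall>F G. P F \<and> P G \<longrightarrow> dist (\<Sum>e\<in>F. a e *\<^sub>C e) (\<Sum>e\<in>G. a e *\<^sub>C e) < \<epsilon>)"
    if "\<epsilon> > 0" for \<epsilon>
  proof -
    have "((\<lambda>e. (cmod (a e))\<^sup>2) has_sum S) E" using s by (simp add: S_def)
    then have "\<forall>\<^sub>F F in finite_subsets_at_top E. dist (\<Sum>e\<in>F. (cmod (a e))\<^sup>2) S < (\<epsilon>/2)\<^sup>2"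
      unfolding has_sum_def by (rule tendstoD) (use that in simp)
    then obtain F0 where F0: "finite F0" "F0 \<subseteq> E" "dist (\<Sum>e\<in>F0. (cmod (a e))\<^sup>2) S < (\<epsilon>/2)\<^sup>2"
      unfolding eventually_finite_subsets_at_top by blast
    have close: "dist (\<Sum>e\<in>F. a e *\<^sub>C e) (\<Sum>e\<in>F0. a e *\<^sub>C e) < \<epsilon>/2"
      if F: "finite F" "F0 \<subseteq> F" "F \<subseteq> E" for F
    proof -
      have "(\<Sum>e\<in>F. a e *\<^sub>C e) - (\<Sum>e\<in>F0. a e *\<^sub>C e) = (\<Sum>e\<in>F-F0. a e *\<^sub>C e)"
        using F by (simp add: sum_diff)
      then have "(norm ((\<Sum>e\<in>F. a e *\<^sub>C e) - (\<Sum>e\<in>F0. a e *\<^sub>C e)))\<^sup>2 = (\<Sum>e\<in>F-F0. (cmod (a e))\<^sup>2)"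
        using norm_sum_orthonormal[of "F-F0" a] F orthonormal_mono[OF E, of "F-F0"] by auto
      also have "\<dots> = (\<Sum>e\<in>F. (cmod (a e))\<^sup>2) - (\<Sum>e\<in>F0. (cmod (a e))\<^sup>2)"
        using F by (simp add: sum_diff)
      also have "\<dots> < (\<epsilon>/2)\<^sup>2"
      proof -
        have "(\<Sum>e\<in>F. (cmod (a e))\<^sup>2) \<le> S"
          unfolding S_def by (rule finite_sum_le_infsum) (use s F in auto)
        then show ?thesis using F0(3) unfolding dist_real_def by linarith
      qed
      finally show ?thesis
        unfolding dist_norm by (rule power2_less_imp_less) (use \<open>\<epsilon> > 0\<close> in simp)
    qed
    show ?thesis
    proof (intro exI[of _ "\<lambda>F. finite F \<and> F0 \<subseteq> F \<and> F \<subseteq> E"] conjI allI impI)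
      show "\<forall>\<^sub>F F in finite_subsets_at_top E. finite F \<and> F0 \<subseteq> F \<and> F \<subseteq> E"
        unfolding eventually_finite_subsets_at_top using F0 by blast
      show "dist (\<Sum>e\<in>F. a e *\<^sub>C e) (\<Sum>e\<in>G. a e *\<^sub>C e) < \<epsilon>"
        if "(finite F \<and> F0 \<subseteq> F \<and> F \<subseteq> E) \<and> (finite G \<and> F0 \<subseteq> G \<and> G \<subseteq> E)" for F G
        by (rule dist_triangle_half_l[of _ "\<Sum>e\<in>F0. a e *\<^sub>C e"]) (use close that in blast)+
    qed
  qed
  then have "cauchy_filter (filtermap (\<lambda>F. \<Sum>e\<in>F. a e *\<^sub>C e) (finite_subsets_at_top E))"
    by (simp add: cauchy_filter_metric_filtermap)
  then have "convergent_filter (filtermap (\<lambda>F. \<Sum>e\<in>F. a e *\<^sub>C e) (finite_subsets_at_top E))"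
    by (intro cauchy_filter_convergent) (simp_all add: filtermap_bot_iff)
  then show ?thesis
    by (simp add: summable_on_def has_sum_def convergent_filter_iff filterlim_def)
qed

lemma orthogonal_closure_span:
  fixes E :: "'a::complex_inner set"
  assumes "\<And>e. e \<in> E \<Longrightarrow> cinner x e = 0" "y \<in> closure (cspan E)"
  shows "cinner x y = 0"
proof -
  have 1: "cinner x y = 0" if "y \<in> cspan E" for y
    using that by (induction rule: cvec.span_induct_alt)
      (simp_all add: assms(1) cinner_add_right)
  have "closed {y. cinner x y = 0}"
    by (intro closed_Collect_eq continuous_intros
        linear_continuous_on bounded_linear_cinner_right)
  then show ?thesis using 1 assms(2) closure_minimal[of "cspan E" "{y. cinner x y = 0}"] by blast
qed

lemma onb_expansion:
  fixes E :: "'a::chilbert_space set"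
  assumes "is_onb E"
  shows "((\<lambda>e. cinner x e *\<^sub>C e) has_sum x) E"
proof -
  have o: "is_orthonormal E" and c: "closure (cspan E) = UNIV" using assms by (auto simp: is_onb_def)
  define y where "y = infsum (\<lambda>e. cinner x e *\<^sub>C e) E"
  have hs: "((\<lambda>e. cinner x e *\<^sub>C e) has_sum y) E"
    unfolding y_def by (intro has_sum_infsum orthonormal_summable o Bessel_summable)
  have "cinner (x - y) e = 0" if "e \<in> E" for e
  proof -
    have "((\<lambda>e'. cinner (cinner x e' *\<^sub>C e') e) has_sum cinner y e) E"
      by (rule has_sum_bounded_linear[OF bounded_linear_cinner_left hs, unfolded o_def])
    moreover have "((\<lambda>e'. cinner (cinner x e' *\<^sub>C e') e) has_sum cinner x e) E"
      by (rule has_sum_finite_neutralI[of "{e}"])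
        (use that o in \<open>auto simp: is_orthonormal_def\<close>)
    ultimately have "cinner y e = cinner x e" by (rule has_sum_unique)
    then show ?thesis by (simp add: cinner_diff_left)
  qed
  then have "cinner (x - y) (x - y) = 0" by (rule orthogonal_closure_span) (use c in auto)
  then have "x = y" by (simp add: cinner_self)
  then show ?thesis using hs by simp
qed

lemma onb_Parseval_cinner:
  fixes E :: "'a::chilbert_space set"
  assumes "is_onb E"
  shows "((\<lambda>e. cinner x e * cinner e y) has_sum cinner x y) E"
  using has_sum_bounded_linear[OF bounded_linear_cinner_left onb_expansion[OF assms]]
  by (simp add: o_def)

lemma onb_Parseval:
  fixes E :: "'a::chilbert_space set"
  assumes "is_onb E"
  shows "((\<lambda>e. (cmod (cinner x e))\<^sup>2) has_sum (norm x)\<^sup>2) E"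
proof -
  have "cinner x e * cinner e x = complex_of_real ((cmod (cinner x e))\<^sup>2)" for e
    by (metis cinner_commute complex_norm_square of_real_power)
  then have "((\<lambda>e. complex_of_real ((cmod (cinner x e))\<^sup>2)) has_sum complex_of_real ((norm x)\<^sup>2)) E"
    using onb_Parseval_cinner[OF assms, of x x] by (simp only: cinner_self)
  then show ?thesis by (simp only: has_sum_of_real_iff)
qed

lemma onb_exists: "\<exists>E :: 'a::chilbert_space set. is_onb E"
proof -
  have "\<exists>M\<in>Collect is_orthonormal. \<forall>X\<in>Collect is_orthonormal. M \<subseteq> X \<longrightarrow> X = (M::'a set)"
  proof (rule subset_Zorn)
    fix C :: "'a set set"
    assume C: "subset.chain (Collect is_orthonormal) C"
    show "\<exists>U\<in>Collect is_orthonormal. \<forall>X\<in>C. X \<subseteq> U"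
    proof (intro bexI[of _ "\<Union>C"] ballI)
      show "\<Union>C \<in> Collect is_orthonormal"
        unfolding mem_Collect_eq is_orthonormal_def
      proof (intro ballI)
        fix e f assume "e \<in> \<Union>C" "f \<in> \<Union>C"
        then obtain X Y where XY: "X \<in> C" "e \<in> X" "Y \<in> C" "f \<in> Y" by blast
        then have "X \<subseteq> Y \<or> Y \<subseteq> X"
          using C unfolding subset_chain_def by blast
        then obtain X where "X \<in> C" "e \<in> X" "f \<in> X" using XY by blast
        then show "cinner e f = (if e = f then 1 else 0)"
          using C unfolding subset.chain_def is_orthonormal_def by blast
      qed
    qed auto
  qed
  then obtain E :: "'a set" where E: "is_orthonormal E"
    and max: "\<And>X. is_orthonormal X \<Longrightarrow> E \<subseteq> X \<Longrightarrow> X = E" by auto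
  have "x \<in> closure (cspan E)" for x
  proof -
    define y where "y = infsum (\<lambda>e. cinner x e *\<^sub>C e) E"
    have hs: "((\<lambda>e. cinner x e *\<^sub>C e) has_sum y) E"
      unfolding y_def by (intro has_sum_infsum orthonormal_summable E Bessel_summable)
    have orth: "cinner (x - y) e = 0" if "e \<in> E" for e
    proof -
      have "((\<lambda>e'. cinner (cinner x e' *\<^sub>C e') e) has_sum cinner y e) E"
        by (rule has_sum_bounded_linear[OF bounded_linear_cinner_left hs, unfolded o_def])
      moreover have "((\<lambda>e'. cinner (cinner x e' *\<^sub>C e') e) has_sum cinner x e) E"
        by (rule has_sum_finite_neutralI[of "{e}"])
          (use that E in \<open>auto simp: is_orthonormal_def\<close>)
      ultimately have "cinner y e = cinner x e" by (rule has_sum_unique)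
      then show ?thesis by (simp add: cinner_diff_left)
    qed
    have "x = y"
    proof (rule ccontr)
      assume "x \<noteq> y"
      define u where "u = complex_of_real (1 / norm (x - y)) *\<^sub>C (x - y)"
      have u1: "cinner u u = 1"
        using \<open>x \<noteq> y\<close> by (simp add: cinner_self u_def norm_divide)
      have u0: "cinner u e = 0" "cinner e u = 0" if "e \<in> E" for e
        using orth[OF that] cinner_commute[of e "x - y"] by (simp_all add: u_def)
      have "is_orthonormal (insert u E)"
        using E u1 u0 by (auto simp: is_orthonormal_def)
      then have "u \<in> E" using max by blast
      then show False using u0[of u] u1 by simp
    qed
    moreover have "y \<in> closure (cspan E)"
    proof (rule Lim_in_closed_set)
      show "((sum (\<lambda>e. cinner x e *\<^sub>C e)) \<longlongrightarrow> y) (finite_subsets_at_top E)"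
        using hs by (simp add: has_sum_def)
      show "\<forall>\<^sub>F F in finite_subsets_at_top E. (\<Sum>e\<in>F. cinner x e *\<^sub>C e) \<in> closure (cspan E)"
        by (rule eventually_finite_subsets_at_top_weakI)
          (intro closure_subset[THEN subsetD] cvec.span_sum cvec.span_scale cvec.span_base, blast)
    qed auto
    ultimately show ?thesis by simp
  qed
  then have "closure (cspan E) = UNIV" by blast
  then show ?thesis using E unfolding is_onb_def by blast
qed

section \<open>Hilbert--Schmidt operators\<close>

definition hilbert_schmidt :: "('a::chilbert_space \<Rightarrow> 'b::chilbert_space) \<Rightarrow> bool"
  where "hilbert_schmidt T \<longleftrightarrow>
    clinear_op T \<and> (\<exists>E. is_onb E \<and> (\<lambda>e. (norm (T e))\<^sup>2) summable_on E)"

lemma clinear_op_bounded: "clinear_op T \<Longrightarrow> bounded_linear T"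
  by (simp add: clinear_op_def)

lemma clinear_op_scaleC: "clinear_op T \<Longrightarrow> T (c *\<^sub>C x) = c *\<^sub>C T x"
  by (simp add: clinear_op_def)

lemma clinear_op_zero: "clinear_op (\<lambda>_. 0)"
  by (simp add: clinear_op_def bounded_linear_zero)

lemma clinear_op_add: "clinear_op S \<Longrightarrow> clinear_op T \<Longrightarrow> clinear_op (\<lambda>x. S x + T x)"
  by (simp add: clinear_op_def bounded_linear_add scaleC_add_right)

lemma clinear_op_scale: "clinear_op T \<Longrightarrow> clinear_op (\<lambda>x. c *\<^sub>C T x)"
  by (simp add: clinear_op_def mult.commute
      bounded_linear_compose[OF bounded_linear_scaleC_right, of T c])

lemma clinear_op_adjoint:
  fixes T :: "'a::chilbert_space \<Rightarrow> 'b::chilbert_space"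
  assumes T: "clinear_op T"
  obtains t where "\<And>x. cinner (T x) g = cinner x t"
proof -
  obtain E :: "'a set" where E: "is_onb E" using onb_exists by blast
  then have o: "is_orthonormal E" by (simp add: is_onb_def)
  define \<phi> where "\<phi> x = cinner (T x) g" for x
  have bl: "bounded_linear \<phi>"
    unfolding \<phi>_def
    by (rule bounded_linear_compose[OF bounded_linear_cinner_left clinear_op_bounded[OF T]])
  have sc: "\<phi> (c *\<^sub>C x) = c * \<phi> x" for c x
    by (simp add: \<phi>_def clinear_op_scaleC[OF T])
  obtain K where K: "\<And>x. cmod (\<phi> x) \<le> norm x * K"
    using bounded_linear.bounded[OF bl] by blast
  have fin: "(\<Sum>e\<in>F. (cmod (\<phi> e))\<^sup>2) \<le> K\<^sup>2" if F: "finite F" "F \<subseteq> E" for F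
  proof -
    define s where "s = (\<Sum>e\<in>F. (cmod (\<phi> e))\<^sup>2)"
    define x where "x = (\<Sum>e\<in>F. cnj (\<phi> e) *\<^sub>C e)"
    have "\<phi> x = (\<Sum>e\<in>F. cnj (\<phi> e) * \<phi> e)"
      unfolding x_def by (simp add: linear_sum[OF bounded_linear.linear[OF bl]] sc)
    also have "\<dots> = complex_of_real s"
      by (simp add: s_def complex_norm_square mult.commute del: of_real_power)
    finally have 1: "cmod (\<phi> x) = s"
      by (simp only: norm_of_real) (simp add: s_def sum_nonneg)
    have 2: "(norm x)\<^sup>2 = s"
      unfolding x_def s_def
      using norm_sum_orthonormal[OF orthonormal_mono[OF o F(2)] F(1), of "\<lambda>e. cnj (\<phi> e)"] by simp
    have "norm x * norm x \<le> norm x * K"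
      using K[of x] 1 2 by (simp add: power2_eq_square)
    then have "norm x \<le> \<bar>K\<bar>"
      by (cases "x = 0") simp_all
    then show ?thesis
      using 2 s_def by (metis abs_ge_zero norm_ge_zero power2_abs power_mono)
  qed
  have "(\<lambda>e. (cmod (cnj (\<phi> e)))\<^sup>2) summable_on E"
    by (rule nonneg_bdd_above_summable_on) (auto intro!: bdd_aboveI2[of _ _ "K\<^sup>2"] fin)
  then have "(\<lambda>e. cnj (\<phi> e) *\<^sub>C e) summable_on E" by (rule orthonormal_summable[OF o])
  then obtain t where t: "((\<lambda>e. cnj (\<phi> e) *\<^sub>C e) has_sum t) E" by (auto simp: summable_on_def)
  have te: "cinner e t = \<phi> e" if "e \<in> E" for e
  proof -
    have "((\<lambda>e'. cinner e (cnj (\<phi> e') *\<^sub>C e')) has_sum cinner e t) E"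
      by (rule has_sum_bounded_linear[OF bounded_linear_cinner_right t, unfolded o_def])
    moreover have "((\<lambda>e'. cinner e (cnj (\<phi> e') *\<^sub>C e')) has_sum \<phi> e) E"
      by (rule has_sum_finite_neutralI[of "{e}"]) (use that o in \<open>auto simp: is_orthonormal_def\<close>)
    ultimately show ?thesis by (rule has_sum_unique)
  qed
  have "cinner (T x) g = cinner x t" for x
  proof -
    have "((\<lambda>e. \<phi> (cinner x e *\<^sub>C e)) has_sum \<phi> x) E"
      by (rule has_sum_bounded_linear[OF bl onb_expansion[OF E], unfolded o_def])
    then have "((\<lambda>e. cinner x e * cinner e t) has_sum \<phi> x) E"
      by (rule has_sum_cong[THEN iffD1, rotated]) (simp add: sc te)
    then show ?thesis
      using onb_Parseval_cinner[OF E, of x t] has_sum_unique unfolding \<phi>_def by blast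
  qed
  then show ?thesis using that by blast
qed

lemma has_sum_nonneg_swap:
  fixes a :: "'i \<Rightarrow> 'j \<Rightarrow> real"
  assumes nn: "\<And>i j. a i j \<ge> 0"
    and r: "\<And>i. i \<in> I \<Longrightarrow> ((\<lambda>j. a i j) has_sum r i) J" and S: "(r has_sum S) I"
    and c: "\<And>j. j \<in> J \<Longrightarrow> ((\<lambda>i. a i j) has_sum c j) I"
  shows "(c has_sum S) J"
proof -
  have "(\<lambda>(i, j). a i j) summable_on Sigma I (\<lambda>_. J)"
    using r S nn by (intro summable_on_SigmaI[where g = r]) (auto simp: summable_on_def)
  then have "((\<lambda>(i, j). a i j) has_sum S) (I \<times> J)"
    using r S by (intro has_sum_SigmaI[where g = r]) auto
  then have "((\<lambda>(j, i). a i j) has_sum S) (J \<times> I)"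
    by (subst has_sum_swap) simp
  then show ?thesis
    using c has_sum_SigmaD[where f = "\<lambda>(j, i). a i j" and A = J and B = "\<lambda>_. I"] by auto
qed

text \<open>The Hilbert--Schmidt norm does not depend on the orthonormal basis.\<close>

lemma hs_norm_onb_independent:
  fixes T :: "'a::chilbert_space \<Rightarrow> 'b::chilbert_space"
  assumes T: "clinear_op T" and E: "is_onb E" and E': "is_onb E'"
    and s: "((\<lambda>e. (norm (T e))\<^sup>2) has_sum S) E"
  shows "((\<lambda>e. (norm (T e))\<^sup>2) has_sum S) E'"
proof -
  obtain G :: "'b set" where G: "is_onb G" using onb_exists by blast
  have "\<exists>t. \<forall>x. cinner (T x) g = cinner x t" for g
    using clinear_op_adjoint[OF T] by metis
  then obtain t where t: "\<And>x g. cinner (T x) g = cinner x (t g)" by metis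
  have row: "((\<lambda>g. (cmod (cinner e (t g)))\<^sup>2) has_sum (norm (T e))\<^sup>2) G" for e
    using onb_Parseval[OF G, of "T e"] by (simp add: t)
  have col: "((\<lambda>e. (cmod (cinner e (t g)))\<^sup>2) has_sum (norm (t g))\<^sup>2) D" if "is_onb D" for g D
    using onb_Parseval[OF that, of "t g"] by (metis (no_types, lifting) cinner_commute complex_mod_cnj has_sum_cong)
  have "((\<lambda>g. (norm (t g))\<^sup>2) has_sum S) G"
    by (rule has_sum_nonneg_swap[where a = "\<lambda>e g. (cmod (cinner e (t g)))\<^sup>2", OF _ row s col[OF E]]) simp
  then show ?thesis
    by (rule has_sum_nonneg_swap[where a = "\<lambda>g e. (cmod (cinner e (t g)))\<^sup>2", OF _ col[OF E'] _ row, rotated]) simp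
qed

lemma hilbert_schmidt_summable:
  assumes "hilbert_schmidt T" "is_onb E"
  shows "(\<lambda>e. (norm (T e))\<^sup>2) summable_on E"
  using assms hs_norm_onb_independent unfolding hilbert_schmidt_def summable_on_def by blast

lemma hilbert_schmidtI:
  fixes T :: "'a::chilbert_space \<Rightarrow> 'b::chilbert_space"
  assumes "clinear_op T" "\<And>E. is_onb E \<Longrightarrow> (\<lambda>e. (norm (T e))\<^sup>2) summable_on E"
  shows "hilbert_schmidt T"
  using assms onb_exists unfolding hilbert_schmidt_def by blast

lemma hilbert_schmidt_zero: "hilbert_schmidt (\<lambda>_. 0)"
  by (rule hilbert_schmidtI) (simp_all add: clinear_op_zero)

lemma hilbert_schmidt_scale: "hilbert_schmidt T \<Longrightarrow> hilbert_schmidt (\<lambda>x. c *\<^sub>C T x)"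
  using hilbert_schmidt_summable[of T]
  by (intro hilbert_schmidtI)
    (auto simp: hilbert_schmidt_def clinear_op_scale power_mult_distrib intro!: summable_on_cmult_right)

lemma hilbert_schmidt_add:
  assumes "hilbert_schmidt S" "hilbert_schmidt T"
  shows "hilbert_schmidt (\<lambda>x. S x + T x)"
proof (rule hilbert_schmidtI)
  show "clinear_op (\<lambda>x. S x + T x)" using assms by (simp add: hilbert_schmidt_def clinear_op_add)
  fix E :: "'a set" assume E: "is_onb E"
  show "(\<lambda>e. (norm (S e + T e))\<^sup>2) summable_on E"
  proof (rule summable_on_comparison_test)
    show "(\<lambda>e. 2 * (norm (S e))\<^sup>2 + 2 * (norm (T e))\<^sup>2) summable_on E"
      by (intro summable_on_add summable_on_cmult_right hilbert_schmidt_summable assms E)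
    fix e
    have "(norm (S e + T e))\<^sup>2 \<le> (norm (S e) + norm (T e))\<^sup>2"
      by (simp add: power_mono norm_triangle_ineq)
    also have "\<dots> \<le> 2 * (norm (S e))\<^sup>2 + 2 * (norm (T e))\<^sup>2"
      using sum_squares_bound[of "norm (S e)" "norm (T e)"] by (simp add: power2_sum)
    finally show "(norm (S e + T e))\<^sup>2 \<le> 2 * (norm (S e))\<^sup>2 + 2 * (norm (T e))\<^sup>2" .
  qed simp
qed

typedef (overloaded) ('a::chilbert_space, 'b::chilbert_space) hs_op =
    "{T :: 'a \<Rightarrow> 'b. hilbert_schmidt T}"
  morphisms hs_apply Abs_hs_op
  using hilbert_schmidt_zero by blast

lemma hilbert_schmidt_hs_apply: "hilbert_schmidt (hs_apply T)"
  using hs_apply[of T] by simp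

lemma clinear_op_hs_apply: "clinear_op (hs_apply T)"
  using hilbert_schmidt_hs_apply[of T] by (simp add: hilbert_schmidt_def)

lemma hs_apply_Abs: "hilbert_schmidt T \<Longrightarrow> hs_apply (Abs_hs_op T) = T"
  by (simp add: Abs_hs_op_inverse)

lemma hs_op_eqI: "(\<And>x. hs_apply S x = hs_apply T x) \<Longrightarrow> S = T"
  by (metis ext hs_apply_inject)

lemma hs_summable: "is_onb E \<Longrightarrow> (\<lambda>e. (norm (hs_apply T e))\<^sup>2) summable_on E"
  by (rule hilbert_schmidt_summable[OF hilbert_schmidt_hs_apply])

lemma hs_summable_cinner:
  assumes "is_onb E"
  shows "(\<lambda>e. cinner (hs_apply S e) (hs_apply T e)) summable_on E"
proof (rule abs_summable_summable, rule summable_on_comparison_test)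
  show "(\<lambda>e. (norm (hs_apply S e))\<^sup>2 + (norm (hs_apply T e))\<^sup>2) summable_on E"
    by (intro summable_on_add hs_summable assms)
  fix e
  have "norm (cinner (hs_apply S e) (hs_apply T e)) \<le> norm (hs_apply S e) * norm (hs_apply T e)"
    by (rule cinner_Cauchy_Schwarz)
  also have "\<dots> \<le> 2 * norm (hs_apply S e) * norm (hs_apply T e)"
    by simp
  also have "\<dots> \<le> (norm (hs_apply S e))\<^sup>2 + (norm (hs_apply T e))\<^sup>2"
    by (rule sum_squares_bound)
  finally show "norm (cinner (hs_apply S e) (hs_apply T e))
    \<le> (norm (hs_apply S e))\<^sup>2 + (norm (hs_apply T e))\<^sup>2" .
qed simp

instantiation hs_op :: (chilbert_space, chilbert_space) complex_inner
begin

definition "0 = Abs_hs_op (\<lambda>_. 0)"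
definition "S + T = Abs_hs_op (\<lambda>x. hs_apply S x + hs_apply T x)"
definition "S - T = Abs_hs_op (\<lambda>x. hs_apply S x - hs_apply T x)"
definition "- T = Abs_hs_op (\<lambda>x. - hs_apply T x)"
definition "r *\<^sub>R T = Abs_hs_op (\<lambda>x. r *\<^sub>R hs_apply T x)"
definition "c *\<^sub>C T = Abs_hs_op (\<lambda>x. c *\<^sub>C hs_apply T x)"

text \<open>
  The choice of the orthonormal basis is immaterial, see \<open>cinner_hs_onb\<close> below.
\<close>

definition "cinner S T =
  (\<Sum>\<^sub>\<infinity>e\<in>(SOME E. is_onb E). cinner (hs_apply S e) (hs_apply T e))"

definition "inner S T = Re (cinner S T)" for S T :: "('a, 'b) hs_op"
definition "norm T = sqrt (inner T T)" for T :: "('a, 'b) hs_op"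
definition "sgn T = inverse (norm T) *\<^sub>R T" for T :: "('a, 'b) hs_op"
definition "dist S T = norm (S - T)" for S T :: "('a, 'b) hs_op"
definition [code del]: "(uniformity :: (('a, 'b) hs_op \<times> ('a, 'b) hs_op) filter) =
  (INF e\<in>{0<..}. principal {(S, T). dist S T < e})"
definition [code del]: "open U \<longleftrightarrow> (\<forall>S\<in>U. \<forall>\<^sub>F (S', T) in uniformity. S' = S \<longrightarrow> T \<in> U)"
  for U :: "('a, 'b) hs_op set"

lemma hs_apply_zero: "hs_apply 0 x = 0"
  by (simp add: zero_hs_op_def hs_apply_Abs hilbert_schmidt_zero)

lemma hs_apply_add: "hs_apply (S + T) x = hs_apply S x + hs_apply T x"
  by (simp add: plus_hs_op_def hs_apply_Abs hilbert_schmidt_add hilbert_schmidt_hs_apply)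

lemma hs_apply_scaleC: "hs_apply (c *\<^sub>C T) x = c *\<^sub>C hs_apply T x"
  by (simp add: scaleC_hs_op_def hs_apply_Abs hilbert_schmidt_scale hilbert_schmidt_hs_apply)

lemma hs_apply_scaleR: "hs_apply (r *\<^sub>R T) x = r *\<^sub>R hs_apply T x"
  by (simp add: scaleR_hs_op_def scaleR_scaleC hs_apply_Abs hilbert_schmidt_scale
      hilbert_schmidt_hs_apply)

lemma hs_apply_uminus: "hs_apply (- T) x = - hs_apply T x"
  using hs_apply_Abs[OF hilbert_schmidt_scale[OF hilbert_schmidt_hs_apply, of "- 1" T]]
  by (simp add: uminus_hs_op_def)

lemma hs_apply_diff: "hs_apply (S - T) x = hs_apply S x - hs_apply T x"
proof -
  have "hilbert_schmidt (\<lambda>x. hs_apply S x + (- 1) *\<^sub>C hs_apply T x)"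
    by (intro hilbert_schmidt_add hilbert_schmidt_scale hilbert_schmidt_hs_apply)
  then show ?thesis
    unfolding minus_hs_op_def by (simp add: hs_apply_Abs)
qed

lemmas hs_apply_simps = hs_apply_zero hs_apply_add hs_apply_scaleC hs_apply_scaleR
  hs_apply_uminus hs_apply_diff

lemma some_onb: "is_onb (SOME E :: 'a set. is_onb E)"
  using onb_exists by (rule someI_ex)

instance
proof
  fix S T U :: "('a, 'b) hs_op" and r s :: real and c d :: complex
  show "S + T + U = S + (T + U)" "S + T = T + S" "0 + S = S" "- S + S = 0" "S - T = S + - T"
    by (rule hs_op_eqI; simp add: hs_apply_simps)+
  show "r *\<^sub>R (S + T) = r *\<^sub>R S + r *\<^sub>R T" "(r + s) *\<^sub>R T = r *\<^sub>R T + s *\<^sub>R T"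
    "r *\<^sub>R s *\<^sub>R T = (r * s) *\<^sub>R T" "1 *\<^sub>R T = T"
    by (rule hs_op_eqI; simp add: hs_apply_simps scaleR_add_right scaleR_add_left)+
  show "c *\<^sub>C (S + T) = c *\<^sub>C S + c *\<^sub>C T" "(c + d) *\<^sub>C T = c *\<^sub>C T + d *\<^sub>C T"
    "c *\<^sub>C d *\<^sub>C T = (c * d) *\<^sub>C T" "1 *\<^sub>C T = T" "r *\<^sub>R T = complex_of_real r *\<^sub>C T"
    by (rule hs_op_eqI; simp add: hs_apply_simps scaleC_add_right scaleC_add_left scaleR_scaleC)+
  show "sgn T = inverse (norm T) *\<^sub>R T" by (rule sgn_hs_op_def)
  show "dist S T = norm (S - T)" by (rule dist_hs_op_def)
  show "uniformity = (INF e\<in>{0<..}. principal {(S :: ('a, 'b) hs_op, T). dist S T < e})"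
    by (rule uniformity_hs_op_def)
  show "open U \<longleftrightarrow> (\<forall>S\<in>U. \<forall>\<^sub>F (S', T) in uniformity. S' = S \<longrightarrow> T \<in> U)"
    for U :: "('a, 'b) hs_op set" by (rule open_hs_op_def)
  show comm: "cinner S T = cnj (cinner T S)" for S T :: "('a, 'b) hs_op"
    unfolding cinner_hs_op_def infsum_cnj[symmetric] cinner_commute[symmetric] ..
  show add: "cinner (S + T) U = cinner S U + cinner T U" for S T U :: "('a, 'b) hs_op"
    unfolding cinner_hs_op_def hs_apply_add cinner_add_left
    by (rule infsum_add) (rule hs_summable_cinner[OF some_onb])+
  show sc: "cinner (c *\<^sub>C S) T = c * cinner S T" for S T :: "('a, 'b) hs_op" and c
    unfolding cinner_hs_op_def hs_apply_scaleC cinner_scaleC_left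
    by (rule infsum_cmult_right) (rule hs_summable_cinner[OF some_onb])
  show in_eq: "inner S T = Re (cinner S T)" for S T :: "('a, 'b) hs_op" by (rule inner_hs_op_def)
  show "inner S T = inner T S" using comm[of S T] by (simp add: in_eq)
  show "inner (S + T) U = inner S U + inner T U" by (simp add: in_eq add)
  have rc: "r *\<^sub>R T = complex_of_real r *\<^sub>C T" for r and T :: "('a, 'b) hs_op"
    by (rule hs_op_eqI) (simp add: hs_apply_simps scaleR_scaleC)
  show "inner (r *\<^sub>R S) T = r * inner S T" by (simp add: in_eq rc sc)
  have self: "((\<lambda>e. (norm (hs_apply T e))\<^sup>2) has_sum inner T T) (SOME E. is_onb E)"
    for T :: "('a, 'b) hs_op"
    using has_sum_Re[OF has_sum_infsum[OF hs_summable_cinner[OF some_onb, of T T]]]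
    by (simp add: in_eq cinner_hs_op_def cinner_self del: of_real_power)
  show "0 \<le> inner S S" by (rule has_sum_nonneg[OF self]) simp
  show "inner S S = 0 \<longleftrightarrow> S = 0"
  proof
    assume "S = 0"
    then show "inner S S = 0" by (simp add: in_eq cinner_hs_op_def hs_apply_zero)
  next
    assume 0: "inner S S = 0"
    have z: "hs_apply S e = 0" if "e \<in> (SOME E. is_onb E)" for e
      using nonneg_has_sum_le_0D[OF self _ _ that] 0 by simp
    show "S = 0"
    proof (rule hs_op_eqI)
      fix x
      have "((\<lambda>e. hs_apply S (cinner x e *\<^sub>C e)) has_sum hs_apply S x) (SOME E. is_onb E)"
        by (rule has_sum_bounded_linear[OF clinear_op_bounded[OF clinear_op_hs_apply]
              onb_expansion[OF some_onb], unfolded o_def])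
      moreover have "((\<lambda>e. hs_apply S (cinner x e *\<^sub>C e)) has_sum 0) (SOME E. is_onb E)"
        by (rule has_sum_0) (simp add: clinear_op_scaleC[OF clinear_op_hs_apply] z)
      ultimately show "hs_apply S x = hs_apply 0 x"
        unfolding hs_apply_zero by (rule has_sum_unique)
    qed
  qed
  show "norm S = sqrt (inner S S)" by (rule norm_hs_op_def)
qed

end

lemma cinner_hs_onb:
  fixes S T :: "('a::chilbert_space, 'b::chilbert_space) hs_op"
  assumes E: "is_onb E"
  shows "((\<lambda>e. cinner (hs_apply S e) (hs_apply T e)) has_sum cinner S T) E"
proof -
  let ?E0 = "SOME E :: 'a set. is_onb E"
  define ip where "ip D S T = (\<Sum>\<^sub>\<infinity>e\<in>D. cinner (hs_apply S e) (hs_apply T e))"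
    for D and S T :: "('a, 'b) hs_op"
  have add: "ip D (S + T) U = ip D S U + ip D T U" if "is_onb D" for D S T U
    unfolding ip_def hs_apply_add cinner_add_left
    by (rule infsum_add) (rule hs_summable_cinner[OF that])+
  have cm: "ip D S T = cnj (ip D T S)" for D S T
    unfolding ip_def infsum_cnj[symmetric] cinner_commute[symmetric] ..
  have sc: "ip D (c *\<^sub>C S) T = c * ip D S T" if "is_onb D" for D S T c
    unfolding ip_def hs_apply_scaleC cinner_scaleC_left
    by (rule infsum_cmult_right) (rule hs_summable_cinner[OF that])
  have ns: "((\<lambda>e. complex_of_real ((norm (hs_apply T e))\<^sup>2)) has_sum ip D T T) D" if "is_onb D" for D T
    using has_sum_infsum[OF hs_summable_cinner[OF that, of T T]]
    by (simp add: ip_def cinner_self del: of_real_power)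
  have diag: "ip E T T = ip ?E0 T T" for T
  proof -
    obtain r where r: "((\<lambda>e. (norm (hs_apply T e))\<^sup>2) has_sum r) E"
      using hs_summable[OF E] unfolding summable_on_def by blast
    have "((\<lambda>e. (norm (hs_apply T e))\<^sup>2) has_sum r) ?E0"
      by (rule hs_norm_onb_independent[OF clinear_op_hs_apply E some_onb r])
    then show ?thesis
      using r ns[OF E, of T] ns[OF some_onb, of T] has_sum_of_real has_sum_unique by metis
  qed
  have add2: "ip D U (S + T) = ip D U S + ip D U T" if "is_onb D" for D S T U
    by (metis add[OF that] cm complex_cnj_add)
  have sc2: "ip D S (c *\<^sub>C T) = cnj c * ip D S T" if "is_onb D" for D S T c
    by (metis sc[OF that] cm complex_cnj_mult)
  have pol: "ip D (S + T) (S + T) + \<i> * ip D (S + \<i> *\<^sub>C T) (S + \<i> *\<^sub>C T)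
      = 2 * ip D S T + (1 + \<i>) * (ip D S S + ip D T T)" if "is_onb D" for D
    by (simp add: add[OF that] add2[OF that] sc[OF that] sc2[OF that] algebra_simps)
  have "ip E S T = ip ?E0 S T"
    using pol[OF E] pol[OF some_onb] by (simp add: diag)
  then show ?thesis
    using has_sum_infsum[OF hs_summable_cinner[OF E, of S T]] by (simp add: ip_def cinner_hs_op_def)
qed

lemma hs_norm_onb:
  fixes T :: "('a::chilbert_space, 'b::chilbert_space) hs_op"
  assumes "is_onb E"
  shows "((\<lambda>e. (norm (hs_apply T e))\<^sup>2) has_sum (norm T)\<^sup>2) E"
  using has_sum_Re[OF cinner_hs_onb[OF assms, of T T]] unfolding cinner_self by simp

lemma norm_hs_apply_le:
  fixes T :: "('a::chilbert_space, 'b::chilbert_space) hs_op"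
  shows "norm (hs_apply T x) \<le> norm T * norm x"
proof -
  obtain E :: "'a set" where E: "is_onb E" using onb_exists by blast
  have bl: "bounded_linear (hs_apply T)" by (rule clinear_op_bounded[OF clinear_op_hs_apply])
  have lim: "((\<lambda>F. norm (\<Sum>e\<in>F. cinner x e *\<^sub>C hs_apply T e)) \<longlongrightarrow> norm (hs_apply T x))
      (finite_subsets_at_top E)"
    using has_sum_bounded_linear[OF bl onb_expansion[OF E]]
    by (auto simp: o_def clinear_op_scaleC[OF clinear_op_hs_apply] has_sum_def intro: tendsto_norm)
  show ?thesis
  proof (rule tendsto_upperbound[OF lim])
    show "\<forall>\<^sub>F F in finite_subsets_at_top E.
        norm (\<Sum>e\<in>F. cinner x e *\<^sub>C hs_apply T e) \<le> norm T * norm x"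
    proof (rule eventually_finite_subsets_at_top_weakI)
      fix F assume F: "finite F" "F \<subseteq> E"
      have "norm (\<Sum>e\<in>F. cinner x e *\<^sub>C hs_apply T e) \<le> (\<Sum>e\<in>F. \<bar>cmod (cinner x e)\<bar> * \<bar>norm (hs_apply T e)\<bar>)"
        by (rule order_trans[OF norm_sum]) simp
      also have "\<dots> \<le> L2_set (\<lambda>e. cmod (cinner x e)) F * L2_set (\<lambda>e. norm (hs_apply T e)) F"
        by (rule L2_set_mult_ineq)
      also have "\<dots> \<le> norm x * norm T"
      proof (rule mult_mono)
        show "L2_set (\<lambda>e. cmod (cinner x e)) F \<le> norm x"
          unfolding L2_set_def
          by (intro real_le_lsqrt finite_sum_le_has_sum[OF onb_Parseval[OF E] F]) simp_all
        show "L2_set (\<lambda>e. norm (hs_apply T e)) F \<le> norm T"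
          unfolding L2_set_def
          by (intro real_le_lsqrt finite_sum_le_has_sum[OF hs_norm_onb[OF E] F]) simp_all
      qed simp_all
      finally show "norm (\<Sum>e\<in>F. cinner x e *\<^sub>C hs_apply T e) \<le> norm T * norm x"
        by (simp add: mult.commute)
    qed
  qed simp
qed

instance hs_op :: (chilbert_space, chilbert_space) chilbert_space
proof
  fix X :: "nat \<Rightarrow> ('a, 'b) hs_op"
  assume X: "Cauchy X"
  obtain E :: "'a set" where E: "is_onb E" using onb_exists by blast
  have "Cauchy (\<lambda>n. hs_apply (X n) x)" for x
  proof (rule metric_CauchyI)
    fix \<epsilon> :: real assume "\<epsilon> > 0"
    then have "\<epsilon> / (norm x + 1) > 0" by (simp add: add_nonneg_pos)
    then obtain M where M: "\<And>m n. m \<ge> M \<Longrightarrow> n \<ge> M \<Longrightarrow> norm (X m - X n) < \<epsilon> / (norm x + 1)"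
      using CauchyD[OF X] by blast
    have "dist (hs_apply (X m) x) (hs_apply (X n) x) < \<epsilon>" if "m \<ge> M" "n \<ge> M" for m n
    proof -
      have "dist (hs_apply (X m) x) (hs_apply (X n) x) \<le> norm (X m - X n) * norm x"
        using norm_hs_apply_le[of "X m - X n" x] by (simp add: dist_norm hs_apply_diff)
      also have "\<dots> \<le> norm (X m - X n) * (norm x + 1)"
        by (simp add: mult_left_mono)
      also have "\<dots> < \<epsilon>"
        using M[OF that] by (simp add: pos_less_divide_eq add_nonneg_pos)
      finally show ?thesis .
    qed
    then show "\<exists>M. \<forall>m\<ge>M. \<forall>n\<ge>M. dist (hs_apply (X m) x) (hs_apply (X n) x) < \<epsilon>" by blast
  qed
  then have "\<exists>y. (\<lambda>n. hs_apply (X n) x) \<longlonglongrightarrow> y" for x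
    by (simp add: Cauchy_convergent_iff convergent_def)
  then obtain T where T: "\<And>x. (\<lambda>n. hs_apply (X n) x) \<longlonglongrightarrow> T x" by metis
  obtain C where C: "\<And>n. norm (X n) \<le> C"
    using Cauchy_Bseq[OF X] by (auto simp: Bseq_def)
  have lin: "linear (hs_apply (X n))" for n
    by (rule bounded_linear.linear[OF clinear_op_bounded[OF clinear_op_hs_apply]])
  have Tadd: "T (x + y) = T x + T y" for x y
    by (rule LIMSEQ_unique[OF T])
      (use tendsto_add[OF T[of x] T[of y]] in \<open>simp add: linear_add[OF lin]\<close>)
  have Tsc: "T (c *\<^sub>C x) = c *\<^sub>C T x" for c x
    by (rule LIMSEQ_unique[OF T])
      (use bounded_linear.tendsto[OF bounded_linear_scaleC_right T[of x], of c] in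
        \<open>simp add: clinear_op_scaleC[OF clinear_op_hs_apply]\<close>)
  have Tbd: "norm (T x) \<le> norm x * C" for x
  proof (rule tendsto_upperbound[OF tendsto_norm[OF T]])
    show "\<forall>\<^sub>F n in sequentially. norm (hs_apply (X n) x) \<le> norm x * C"
    proof (intro always_eventually allI)
      fix n
      have "norm (hs_apply (X n) x) \<le> norm (X n) * norm x" by (rule norm_hs_apply_le)
      also have "\<dots> \<le> C * norm x" by (rule mult_right_mono[OF C]) simp
      finally show "norm (hs_apply (X n) x) \<le> norm x * C" by (simp add: mult.commute)
    qed
  qed simp
  have Tl: "clinear_op T"
    unfolding clinear_op_def
    by (auto simp: Tsc Tadd scaleR_scaleC Tbd intro!: bounded_linear_intro[of T C])
  have le: "(\<Sum>e\<in>F. (norm (T e - hs_apply U e))\<^sup>2) \<le> D\<^sup>2"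
    if D: "\<forall>\<^sub>F n in sequentially. norm (X n - U) \<le> D" and F: "finite F" "F \<subseteq> E" for U D F
  proof (rule tendsto_upperbound)
    show "(\<lambda>n. \<Sum>e\<in>F. (norm (hs_apply (X n) e - hs_apply U e))\<^sup>2)
        \<longlonglongrightarrow> (\<Sum>e\<in>F. (norm (T e - hs_apply U e))\<^sup>2)"
      by (intro tendsto_intros T)
    show "\<forall>\<^sub>F n in sequentially. (\<Sum>e\<in>F. (norm (hs_apply (X n) e - hs_apply U e))\<^sup>2) \<le> D\<^sup>2"
      using D
    proof eventually_elim
      case (elim n)
      have "(\<Sum>e\<in>F. (norm (hs_apply (X n - U) e))\<^sup>2) \<le> (norm (X n - U))\<^sup>2"
        by (rule finite_sum_le_has_sum[OF hs_norm_onb[OF E]]) (use F in auto)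
      also have "\<dots> \<le> D\<^sup>2" using elim by (simp add: power_mono)
      finally show ?case by (simp add: hs_apply_diff)
    qed
  qed simp
  have "(\<lambda>e. (norm (T e))\<^sup>2) summable_on E"
    by (rule nonneg_bdd_above_summable_on)
      (use le[of 0 C] C in \<open>auto simp: hs_apply_zero intro!: bdd_aboveI2[of _ _ "C\<^sup>2"]\<close>)
  then have "hilbert_schmidt T" using Tl E unfolding hilbert_schmidt_def by blast
  then have ap: "hs_apply (Abs_hs_op T) = T" by (rule hs_apply_Abs)
  have "X \<longlonglongrightarrow> Abs_hs_op T"
  proof (rule LIMSEQ_I)
    fix \<epsilon> :: real assume "\<epsilon> > 0"
    then obtain M where M: "\<And>m n. m \<ge> M \<Longrightarrow> n \<ge> M \<Longrightarrow> norm (X m - X n) < \<epsilon> / 2"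
      using CauchyD[OF X, of "\<epsilon> / 2"] by auto
    have "norm (X n - Abs_hs_op T) < \<epsilon>" if n: "n \<ge> M" for n
    proof -
      have ev: "\<forall>\<^sub>F m in sequentially. norm (X m - X n) \<le> \<epsilon> / 2"
        using M n by (intro eventually_sequentiallyI[of M]) (auto intro: less_imp_le)
      have "(norm (Abs_hs_op T - X n))\<^sup>2 \<le> (\<epsilon> / 2)\<^sup>2"
        by (rule has_sum_le_finite_sums[OF hs_norm_onb[OF E]])
          (use le[OF ev] in \<open>simp add: hs_apply_diff ap\<close>)
      then have "norm (Abs_hs_op T - X n) \<le> \<epsilon> / 2"
        by (rule power2_le_imp_le) (use \<open>\<epsilon> > 0\<close> in simp)
      then show ?thesis using \<open>\<epsilon> > 0\<close> by (simp add: norm_minus_commute)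
    qed
    then show "\<exists>M. \<forall>n\<ge>M. norm (X n - Abs_hs_op T) < \<epsilon>" by blast
  qed
  then show "convergent X" by (rule convergentI)
qed

text \<open>The rank-one operator $f \otimes \overline{g}$.\<close>

definition tensor_op :: "'b::chilbert_space \<Rightarrow> 'a::chilbert_space \<Rightarrow> ('a, 'b) hs_op"
  where "tensor_op f g = Abs_hs_op (\<lambda>h. cinner h g *\<^sub>C f)"

lemma hs_apply_tensor_op: "hs_apply (tensor_op f g) h = cinner h g *\<^sub>C f"
proof -
  have "clinear_op (\<lambda>h. cinner h g *\<^sub>C f)"
    by (auto simp: clinear_op_def intro: bounded_linear_compose[OF
        bounded_bilinear.bounded_linear_left[OF bounded_bilinear_scaleC] bounded_linear_cinner_left])
  moreover have "(\<lambda>e. (norm (cinner e g *\<^sub>C f))\<^sup>2) summable_on E" if "is_onb E" for E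
  proof -
    have "cmod (cinner e g) = cmod (cinner g e)" for e
      by (metis cinner_commute complex_mod_cnj)
    then show ?thesis
      using Bessel_summable[of E g] that
      by (simp add: is_onb_def power_mult_distrib summable_on_cmult_left)
  qed
  ultimately show ?thesis
    unfolding tensor_op_def by (simp add: hs_apply_Abs hilbert_schmidtI)
qed

section \<open>Bessel sequences, frames and Riesz bases\<close>

text \<open>
  A sequence is a function together with its index set; the index sets carry no order, so
  infinite sums are unconditional. All bounds refer to the inequalities between squared norms.
  In this normalization the bounds of two sequences multiply when passing to the family of
  tensor products; $\sqrt{A A'}$ and $\sqrt{B B'}$ are the corresponding constants in the
  inequalities between norms, where the coefficients are measured in $\ell^2$.
\<close>

definition bessel_seq :: "'i set \<Rightarrow> ('i \<Rightarrow> 'a::chilbert_space) \<Rightarrow> real \<Rightarrow> bool"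
  where "bessel_seq J x B \<longleftrightarrow>
    (\<forall>h. (\<lambda>j. (cmod (cinner h (x j)))\<^sup>2) summable_on J \<and>
         (\<Sum>\<^sub>\<infinity>j\<in>J. (cmod (cinner h (x j)))\<^sup>2) \<le> B * (norm h)\<^sup>2)"

definition frame_with_bounds :: "'i set \<Rightarrow> ('i \<Rightarrow> 'a::chilbert_space) \<Rightarrow> real \<Rightarrow> real \<Rightarrow> bool"
  where "frame_with_bounds J x A B \<longleftrightarrow> A > 0 \<and> B > 0 \<and>
    (\<forall>h. (\<lambda>j. (cmod (cinner h (x j)))\<^sup>2) summable_on J \<and>
         A * (norm h)\<^sup>2 \<le> (\<Sum>\<^sub>\<infinity>j\<in>J. (cmod (cinner h (x j)))\<^sup>2) \<and>
         (\<Sum>\<^sub>\<infinity>j\<in>J. (cmod (cinner h (x j)))\<^sup>2) \<le> B * (norm h)\<^sup>2)"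

definition is_frame :: "'i set \<Rightarrow> ('i \<Rightarrow> 'a::chilbert_space) \<Rightarrow> bool"
  where "is_frame J x \<longleftrightarrow> (\<exists>A B. frame_with_bounds J x A B)"

definition frame_op :: "'i set \<Rightarrow> ('i \<Rightarrow> 'a::chilbert_space) \<Rightarrow> 'a \<Rightarrow> 'a"
  where "frame_op J x h = (\<Sum>\<^sub>\<infinity>j\<in>J. cinner h (x j) *\<^sub>C x j)"

definition canonical_dual :: "'i set \<Rightarrow> ('i \<Rightarrow> 'a::chilbert_space) \<Rightarrow> 'i \<Rightarrow> 'a"
  where "canonical_dual J x j = inv (frame_op J x) (x j)"

definition dual_frame :: "'i set \<Rightarrow> ('i \<Rightarrow> 'a::chilbert_space) \<Rightarrow> ('i \<Rightarrow> 'a) \<Rightarrow> bool"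
  where "dual_frame J x y \<longleftrightarrow> is_frame J x \<and> is_frame J y \<and>
    (\<forall>h. ((\<lambda>j. cinner h (y j) *\<^sub>C x j) has_sum h) J \<and>
         ((\<lambda>j. cinner h (x j) *\<^sub>C y j) has_sum h) J)"

definition riesz_basis :: "'i set \<Rightarrow> ('i \<Rightarrow> 'a::chilbert_space) \<Rightarrow> bool"
  where "riesz_basis J x \<longleftrightarrow> closure (cspan (x ` J)) = UNIV \<and>
    (\<exists>A B. A > 0 \<and> B > 0 \<and> (\<forall>F c. finite F \<longrightarrow> F \<subseteq> J \<longrightarrow>
       A * (\<Sum>j\<in>F. (cmod (c j))\<^sup>2) \<le> (norm (\<Sum>j\<in>F. c j *\<^sub>C x j))\<^sup>2 \<and>
       (norm (\<Sum>j\<in>F. c j *\<^sub>C x j))\<^sup>2 \<le> B * (\<Sum>j\<in>F. (cmod (c j))\<^sup>2)))"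

definition biorthogonal :: "'i set \<Rightarrow> ('i \<Rightarrow> 'a::chilbert_space) \<Rightarrow> ('i \<Rightarrow> 'a) \<Rightarrow> bool"
  where "biorthogonal J x y \<longleftrightarrow>
    (\<forall>k\<in>J. \<forall>j\<in>J. cinner (x k) (y j) = (if k = j then 1 else 0))"

text \<open>The family $(f_i \otimes \overline{g}_k)_{(i,k)}$.\<close>

definition tensor_family ::
    "('i \<Rightarrow> 'b::chilbert_space) \<Rightarrow> ('k \<Rightarrow> 'a::chilbert_space) \<Rightarrow> 'i \<times> 'k \<Rightarrow> ('a, 'b) hs_op"
  where "tensor_family f g = (\<lambda>(i, k). tensor_op (f i) (g k))"

end

theory Submission
  imports Defs
begin

text \<open>
  Everything rests on the identity \<open>\<langle>T, f \<otimes> g\<rangle> = \<langle>T g, f\<rangle>\<close>. Summing \<open>|\<langle>T g\<^sub>k, f\<^sub>i\<rangle>|\<^sup>2\<close> over \<open>i\<close> compares with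
  \<open>\<parallel>T g\<^sub>k\<parallel>\<^sup>2\<close>, and summing \<open>\<parallel>T g\<^sub>k\<parallel>\<^sup>2 = \<Sum>\<^sub>e |\<langle>T\<^sup>* e, g\<^sub>k\<rangle>|\<^sup>2\<close> over \<open>k\<close> compares with
  \<open>\<Sum>\<^sub>e \<parallel>T\<^sup>* e\<parallel>\<^sup>2 = \<parallel>T\<parallel>\<^sup>2\<close>, so Bessel and frame bounds multiply. The expansion of \<open>T\<close> in a
  tensor product of dual frames converges by the Bessel property and is identified by pairing
  with \<open>v \<otimes> h\<close>. Riesz bases are the frames biorthogonal to one of their duals, a property
  that passes to tensor products.
\<close>

section \<open>Bounds for tensor products\<close>

lemma cmod_cinner_commute: "cmod (cinner x y) = cmod (cinner y x)" for x :: "'a::complex_inner"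
  by (metis cinner_commute complex_mod_cnj)

text \<open>Both sides are the same series over an orthonormal basis. Expanding \<open>g\<close>
  gives the terms <g, e> <T e, f>; in the Hilbert-Schmidt sum the coefficient <e, g> leaves the
  second slot conjugated, hence as <g, e>.\<close>

lemma cinner_tensor_op:
  fixes g :: "'a::chilbert_space" and f :: "'b::chilbert_space"
  shows "cinner T (tensor_op f g) = cinner (hs_apply T g) f"
proof -
  obtain E :: "'a set" where E: "is_onb E" using onb_exists by blast
  have "bounded_linear (\<lambda>x. cinner (hs_apply T x) f)"
    by (rule bounded_linear_compose[OF bounded_linear_cinner_left
          clinear_op_bounded[OF clinear_op_hs_apply]])
  from has_sum_bounded_linear[OF this onb_expansion[OF E]]
  have "((\<lambda>e. cinner g e * cinner (hs_apply T e) f) has_sum cinner (hs_apply T g) f) E"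
    by (simp add: clinear_op_scaleC[OF clinear_op_hs_apply])
  moreover have "((\<lambda>e. cinner g e * cinner (hs_apply T e) f) has_sum cinner T (tensor_op f g)) E"
    using cinner_hs_onb[OF E, of T "tensor_op f g"]
    by (simp add: hs_apply_tensor_op flip: cinner_commute)
  ultimately show ?thesis using has_sum_unique by blast
qed

text \<open>\<open>t\<close> is the adjoint, and it has the same Hilbert-Schmidt norm: the
  nonnegative matrix |<e, t y>|^2 has row sums |T e|^2 and column sums |t y|^2, and the order of
  summation may be exchanged.\<close>

lemma hs_adjoint_norm:
  fixes T :: "('a::chilbert_space, 'b::chilbert_space) hs_op"
  assumes G: "is_onb G"
  obtains t where "\<And>x y. cinner (hs_apply T x) y = cinner x (t y)"
    "((\<lambda>e. (norm (t e))\<^sup>2) has_sum (norm T)\<^sup>2) G"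
proof -
  obtain E :: "'a set" where E: "is_onb E" using onb_exists by blast
  have "\<exists>t. \<forall>x. cinner (hs_apply T x) y = cinner x t" for y
    using clinear_op_adjoint[OF clinear_op_hs_apply[of T]] by metis
  then obtain t where t: "\<And>x y. cinner (hs_apply T x) y = cinner x (t y)" by metis
  have "((\<lambda>e. (norm (t e))\<^sup>2) has_sum (norm T)\<^sup>2) G"
  proof (rule has_sum_nonneg_swap[where a = "\<lambda>e y. (cmod (cinner e (t y)))\<^sup>2"])
    show "((\<lambda>y. (cmod (cinner e (t y)))\<^sup>2) has_sum (norm (hs_apply T e))\<^sup>2) G" for e
      using onb_Parseval[OF G, of "hs_apply T e"] by (simp add: t)
    show "((\<lambda>e. (cmod (cinner e (t y)))\<^sup>2) has_sum (norm (t y))\<^sup>2) E" for y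
      using onb_Parseval[OF E, of "t y"] by (simp add: cmod_cinner_commute)
  qed (use hs_norm_onb[OF E] in simp_all)
  with t that show ?thesis by blast
qed

text \<open>Tonelli with row estimates: the upper estimate makes the row sums summable, hence the
  whole nonnegative double series, and both estimates are then summed over the rows.\<close>

lemma infsum_product_bounds:
  fixes a :: "'i \<times> 'j \<Rightarrow> real"
  assumes nn: "\<And>p. 0 \<le> a p" and r: "(r has_sum R) I"
    and row: "\<And>i. i \<in> I \<Longrightarrow> (\<lambda>j. a (i, j)) summable_on J"
    and lower: "\<And>i. i \<in> I \<Longrightarrow> L * r i \<le> (\<Sum>\<^sub>\<infinity>j\<in>J. a (i, j))"
    and upper: "\<And>i. i \<in> I \<Longrightarrow> (\<Sum>\<^sub>\<infinity>j\<in>J. a (i, j)) \<le> U * r i"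
  shows "a summable_on I \<times> J" "L * R \<le> infsum a (I \<times> J)" "infsum a (I \<times> J) \<le> U * R"
proof -
  define s where "s i = (\<Sum>\<^sub>\<infinity>j\<in>J. a (i, j))" for i
  have s: "((\<lambda>j. a (i, j)) has_sum s i) J" if "i \<in> I" for i
    unfolding s_def using row[OF that] by simp
  have "(\<lambda>i. U * r i) summable_on I"
    using r by (intro summable_on_cmult_right) (auto simp: summable_on_def)
  then have "s summable_on I"
    by (rule summable_on_comparison_test) (auto simp: s_def upper nn infsum_nonneg)
  then show sm: "a summable_on I \<times> J"
    using s nn by (intro summable_on_SigmaI[where g = s]) auto
  then have S: "(s has_sum infsum a (I \<times> J)) I"
    by (intro has_sum_SigmaD[OF has_sum_infsum s])
  show "L * R \<le> infsum a (I \<times> J)"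
    by (rule has_sum_mono[OF has_sum_cmult_right[OF r] S]) (simp add: s_def lower)
  show "infsum a (I \<times> J) \<le> U * R"
    by (rule has_sum_mono[OF S has_sum_cmult_right[OF r]]) (simp add: s_def upper)
qed

section \<open>Two-sided bounds on analysis coefficients\<close>

text \<open>The frame inequalities without sign conditions: \<open>A = 0\<close> gives Bessel
  sequences, so one argument serves both notions.\<close>

definition analysis_bounds :: "'i set \<Rightarrow> ('i \<Rightarrow> 'a::chilbert_space) \<Rightarrow> real \<Rightarrow> real \<Rightarrow> bool"
  where "analysis_bounds J x A B \<longleftrightarrow>
    (\<forall>h. (\<lambda>j. (cmod (cinner h (x j)))\<^sup>2) summable_on J \<and>
         A * (norm h)\<^sup>2 \<le> (\<Sum>\<^sub>\<infinity>j\<in>J. (cmod (cinner h (x j)))\<^sup>2) \<and>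
         (\<Sum>\<^sub>\<infinity>j\<in>J. (cmod (cinner h (x j)))\<^sup>2) \<le> B * (norm h)\<^sup>2)"

lemma bessel_iff_analysis_bounds: "bessel_seq J x B \<longleftrightarrow> analysis_bounds J x 0 B"
  by (auto simp: bessel_seq_def analysis_bounds_def infsum_nonneg)

lemma frame_iff_analysis_bounds:
  "frame_with_bounds J x A B \<longleftrightarrow> A > 0 \<and> B > 0 \<and> analysis_bounds J x A B"
  by (auto simp: frame_with_bounds_def analysis_bounds_def)

text \<open>The bounds of \<open>g\<close> are applied to the vectors \<open>t e\<close>, with
  \<open>t\<close> the adjoint and \<open>e\<close> in an orthonormal basis of the codomain. Summing
  over \<open>k\<close> first yields the bounds, summing over \<open>e\<close> first yields |T
  g_k|^2 by Parseval.\<close>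

lemma analysis_bounds_hs_apply:
  fixes T :: "('a::chilbert_space, 'b::chilbert_space) hs_op"
  assumes g: "analysis_bounds K g A B"
  shows "\<exists>S. ((\<lambda>k. (norm (hs_apply T (g k)))\<^sup>2) has_sum S) K \<and>
    A * (norm T)\<^sup>2 \<le> S \<and> S \<le> B * (norm T)\<^sup>2"
proof -
  obtain G :: "'b set" where G: "is_onb G" using onb_exists by blast
  obtain t where t: "\<And>x y. cinner (hs_apply T x) y = cinner x (t y)"
    and nt: "((\<lambda>e. (norm (t e))\<^sup>2) has_sum (norm T)\<^sup>2) G"
    using hs_adjoint_norm[OF G, of T] by blast
  define a where "a = (\<lambda>(e, k). (cmod (cinner (t e) (g k)))\<^sup>2)"
  have a: "a summable_on G \<times> K" "A * (norm T)\<^sup>2 \<le> infsum a (G \<times> K)"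
    "infsum a (G \<times> K) \<le> B * (norm T)\<^sup>2"
    by (rule infsum_product_bounds[OF _ nt], use g in \<open>auto simp: a_def analysis_bounds_def\<close>)+
  have "((\<lambda>(k, e). a (e, k)) has_sum infsum a (G \<times> K)) (K \<times> G)"
    using has_sum_infsum[OF a(1)] by (subst (asm) has_sum_swap)
  then have "((\<lambda>k. (norm (hs_apply T (g k)))\<^sup>2) has_sum infsum a (G \<times> K)) K"
    by (rule has_sum_SigmaD)
      (use onb_Parseval[OF G] in \<open>simp add: a_def cmod_cinner_commute[of "t _"] flip: t\<close>)
  with a show ?thesis by blast
qed

text \<open>For fixed \<open>k\<close> the bounds of \<open>f\<close> apply to the vector T g_k. The
  signs of \<open>A'\<close> and \<open>B'\<close> enter because these constants multiply the
  estimates for \<open>S\<close>.\<close>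

lemma analysis_bounds_tensor_family:
  fixes g :: "'k \<Rightarrow> 'a::chilbert_space" and f :: "'i \<Rightarrow> 'b::chilbert_space"
  assumes g: "analysis_bounds K g A B" and f: "analysis_bounds I f A' B'"
    and nn: "0 \<le> A'" "0 \<le> B'"
  shows "analysis_bounds (I \<times> K) (tensor_family f g) (A * A') (B * B')"
  unfolding analysis_bounds_def
proof
  fix T :: "('a, 'b) hs_op"
  obtain S where S: "((\<lambda>k. (norm (hs_apply T (g k)))\<^sup>2) has_sum S) K"
    and SA: "A * (norm T)\<^sup>2 \<le> S" and SB: "S \<le> B * (norm T)\<^sup>2"
    using analysis_bounds_hs_apply[OF g] by blast
  define a where "a = (\<lambda>(k, i). (cmod (cinner (hs_apply T (g k)) (f i)))\<^sup>2)"
  have a: "a summable_on K \<times> I" "A' * S \<le> infsum a (K \<times> I)" "infsum a (K \<times> I) \<le> B' * S"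
    by (rule infsum_product_bounds[OF _ S], use f in \<open>auto simp: a_def analysis_bounds_def\<close>)+
  have "((\<lambda>(i, k). a (k, i)) has_sum infsum a (K \<times> I)) (I \<times> K)"
    using has_sum_infsum[OF a(1)] by (subst (asm) has_sum_swap)
  then have h: "((\<lambda>j. (cmod (cinner T (tensor_family f g j)))\<^sup>2) has_sum infsum a (K \<times> I)) (I \<times> K)"
    by (simp add: a_def tensor_family_def case_prod_unfold cinner_tensor_op)
  have "A * A' * (norm T)\<^sup>2 \<le> infsum a (K \<times> I)"
    using mult_left_mono[OF SA nn(1)] a(2) by (simp add: ac_simps)
  moreover have "infsum a (K \<times> I) \<le> B * B' * (norm T)\<^sup>2"
    using mult_left_mono[OF SB nn(2)] a(3) by (simp add: ac_simps)
  ultimately show "(\<lambda>j. (cmod (cinner T (tensor_family f g j)))\<^sup>2) summable_on I \<times> K \<and>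
    A * A' * (norm T)\<^sup>2 \<le> (\<Sum>\<^sub>\<infinity>j\<in>I \<times> K. (cmod (cinner T (tensor_family f g j)))\<^sup>2) \<and>
    (\<Sum>\<^sub>\<infinity>j\<in>I \<times> K. (cmod (cinner T (tensor_family f g j)))\<^sup>2) \<le> B * B' * (norm T)\<^sup>2"
    using h by (auto simp: infsumI summable_on_def)
qed

text \<open>Only the zero space admits a negative Bessel bound. This supplies the sign required to
  multiply Bessel bounds.\<close>

lemma bessel_bound_nonneg:
  fixes x :: "'i \<Rightarrow> 'a::chilbert_space"
  assumes "bessel_seq J x B" "infinite_dim TYPE('a)"
  shows "0 \<le> B"
proof -
  have "\<exists>h :: 'a. h \<noteq> 0"
  proof (rule ccontr)
    assume "\<nexists>h :: 'a. h \<noteq> 0"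
    then have "cspan {} = (UNIV :: 'a set)" by auto
    then show False using assms(2) unfolding infinite_dim_def by blast
  qed
  then obtain h :: 'a where h: "h \<noteq> 0" by blast
  have "0 \<le> (\<Sum>\<^sub>\<infinity>j\<in>J. (cmod (cinner h (x j)))\<^sup>2)" by (simp add: infsum_nonneg)
  also have "\<dots> \<le> B * (norm h)\<^sup>2" using assms(1) by (simp add: bessel_seq_def)
  finally show ?thesis using h by (simp add: zero_le_mult_iff)
qed

lemma frame_tensor_family:
  assumes "frame_with_bounds K g A B" "frame_with_bounds I f A' B'"
  shows "frame_with_bounds (I \<times> K) (tensor_family f g) (A * A') (B * B')"
  using assms by (simp add: frame_iff_analysis_bounds analysis_bounds_tensor_family)

section \<open>The frame operator and the canonical dual\<close>

text \<open>Cauchy criterion on finite subsets: beyond a suitable \<open>F0\<close>, the squared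
  norm of a partial sum over \<open>F - F0\<close> is at most a tail of the convergent series of
  \<open>C * b j\<close>.\<close>

lemma summable_on_norm_sum_bound:
  fixes x :: "'i \<Rightarrow> 'a::banach" and b :: "'i \<Rightarrow> real"
  assumes s: "b summable_on J" and nn: "\<And>j. j \<in> J \<Longrightarrow> 0 \<le> b j" and C: "0 \<le> C"
    and le: "\<And>F. finite F \<Longrightarrow> F \<subseteq> J \<Longrightarrow> (norm (sum x F))\<^sup>2 \<le> C * sum b F"
  shows "x summable_on J"
proof -
  have "\<exists>P. eventually P (finite_subsets_at_top J) \<and>
          (\<forall>F G. P F \<and> P G \<longrightarrow> dist (sum x F) (sum x G) < \<epsilon>)"
    if "\<epsilon> > 0" for \<epsilon>
  proof -
    have "((\<lambda>j. C * b j) has_sum infsum (\<lambda>j. C * b j) J) J"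
      by (intro has_sum_infsum summable_on_cmult_right s)
    then have "\<forall>\<^sub>F F in finite_subsets_at_top J.
        dist (\<Sum>j\<in>F. C * b j) (infsum (\<lambda>j. C * b j) J) < (\<epsilon>/2)\<^sup>2"
      unfolding has_sum_def by (rule tendstoD) (use that in simp)
    then obtain F0 where F0: "finite F0" "F0 \<subseteq> J"
      "dist (\<Sum>j\<in>F0. C * b j) (infsum (\<lambda>j. C * b j) J) < (\<epsilon>/2)\<^sup>2"
      unfolding eventually_finite_subsets_at_top by blast
    have close: "dist (sum x F) (sum x F0) < \<epsilon>/2"
      if F: "finite F" "F0 \<subseteq> F" "F \<subseteq> J" for F
    proof -
      have "(norm (sum x F - sum x F0))\<^sup>2 \<le> C * sum b (F - F0)"
        using le[of "F - F0"] F by (auto simp: sum_diff)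
      also have "\<dots> = (\<Sum>j\<in>F. C * b j) - (\<Sum>j\<in>F0. C * b j)"
        using F by (simp add: sum_diff right_diff_distrib sum_distrib_left)
      also have "\<dots> < (\<epsilon>/2)\<^sup>2"
      proof -
        have "(\<Sum>j\<in>F. C * b j) \<le> infsum (\<lambda>j. C * b j) J"
          by (rule finite_sum_le_infsum) (use s F nn C in \<open>auto intro: summable_on_cmult_right\<close>)
        then show ?thesis using F0(3) unfolding dist_real_def by linarith
      qed
      finally show ?thesis
        unfolding dist_norm by (rule power2_less_imp_less) (use \<open>\<epsilon> > 0\<close> in simp)
    qed
    show ?thesis
    proof (intro exI[of _ "\<lambda>F. finite F \<and> F0 \<subseteq> F \<and> F \<subseteq> J"] conjI allI impI)
      show "\<forall>\<^sub>F F in finite_subsets_at_top J. finite F \<and> F0 \<subseteq> F \<and> F \<subseteq> J"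
        unfolding eventually_finite_subsets_at_top using F0 by blast
      show "dist (sum x F) (sum x G) < \<epsilon>"
        if "(finite F \<and> F0 \<subseteq> F \<and> F \<subseteq> J) \<and> (finite G \<and> F0 \<subseteq> G \<and> G \<subseteq> J)" for F G
        by (rule dist_triangle_half_l[of _ "sum x F0"]) (use close that in blast)+
    qed
  qed
  then have "cauchy_filter (filtermap (sum x) (finite_subsets_at_top J))"
    by (simp add: cauchy_filter_metric_filtermap)
  then have "convergent_filter (filtermap (sum x) (finite_subsets_at_top J))"
    by (intro cauchy_filter_convergent) (simp_all add: filtermap_bot_iff)
  then show ?thesis
    by (simp add: summable_on_def has_sum_def convergent_filter_iff filterlim_def)
qed

lemma cmod_sum_mult_le_L2:
  "cmod (\<Sum>j\<in>F. c j * d j) \<le> sqrt (\<Sum>j\<in>F. (cmod (c j))\<^sup>2) * sqrt (\<Sum>j\<in>F. (cmod (d j))\<^sup>2)"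
proof -
  have "cmod (\<Sum>j\<in>F. c j * d j) \<le> (\<Sum>j\<in>F. \<bar>cmod (c j)\<bar> * \<bar>cmod (d j)\<bar>)"
    by (rule order_trans[OF norm_sum]) (simp add: norm_mult)
  also have "\<dots> \<le> sqrt (\<Sum>j\<in>F. (cmod (c j))\<^sup>2) * sqrt (\<Sum>j\<in>F. (cmod (d j))\<^sup>2)"
    using L2_set_mult_ineq[of "\<lambda>j. cmod (c j)" "\<lambda>j. cmod (d j)" F] by (simp add: L2_set_def)
  finally show ?thesis .
qed

lemma bessel_seq_finite_sum_le:
  assumes "bessel_seq J x B" "finite F" "F \<subseteq> J"
  shows "(\<Sum>j\<in>F. (cmod (cinner h (x j)))\<^sup>2) \<le> B * (norm h)\<^sup>2"
proof -
  have "(\<Sum>j\<in>F. (cmod (cinner h (x j)))\<^sup>2) \<le> (\<Sum>\<^sub>\<infinity>j\<in>J. (cmod (cinner h (x j)))\<^sup>2)"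
    by (rule finite_sum_le_infsum) (use assms in \<open>auto simp: bessel_seq_def\<close>)
  then show ?thesis using assms(1) by (auto simp: bessel_seq_def intro: order_trans)
qed

text \<open>Synthesis is the adjoint of analysis and so inherits its norm bound: pair the sum
  \<open>s\<close> with itself, apply Cauchy-Schwarz to the coefficients, and cancel one factor
  \<open>norm s\<close>.\<close>

lemma bessel_seq_norm_sum_le:
  fixes x :: "'i \<Rightarrow> 'a::chilbert_space"
  assumes x: "bessel_seq J x B" and B: "0 \<le> B" and F: "finite F" "F \<subseteq> J"
  shows "(norm (\<Sum>j\<in>F. c j *\<^sub>C x j))\<^sup>2 \<le> B * (\<Sum>j\<in>F. (cmod (c j))\<^sup>2)"
proof -
  define s where "s = (\<Sum>j\<in>F. c j *\<^sub>C x j)"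
  let ?c = "\<Sum>j\<in>F. (cmod (c j))\<^sup>2"
  have "cinner s s = (\<Sum>j\<in>F. c j * cinner (x j) s)"
    unfolding s_def by (subst cinner_sum_left) simp
  then have "(norm s)\<^sup>2 = cmod (\<Sum>j\<in>F. c j * cinner (x j) s)"
    by (metis abs_of_nonneg cinner_self norm_of_real zero_le_power2)
  also have "\<dots> \<le> sqrt ?c * sqrt (\<Sum>j\<in>F. (cmod (cinner (x j) s))\<^sup>2)"
    by (rule cmod_sum_mult_le_L2)
  also have "\<dots> \<le> sqrt ?c * sqrt (B * (norm s)\<^sup>2)"
    using bessel_seq_finite_sum_le[OF x F, of s]
    by (intro mult_left_mono) (simp_all add: cmod_cinner_commute[of s] sum_nonneg)
  also have "\<dots> = (sqrt ?c * sqrt B) * norm s"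
    by (simp add: real_sqrt_mult)
  finally have "norm s * norm s \<le> (sqrt ?c * sqrt B) * norm s"
    by (simp add: power2_eq_square)
  then have "norm s \<le> sqrt ?c * sqrt B"
    using B by (cases "s = 0") (auto simp: sum_nonneg)
  then have "(norm s)\<^sup>2 \<le> (sqrt ?c * sqrt B)\<^sup>2" by (rule power_mono) simp
  also have "\<dots> = B * ?c" using B by (simp add: power_mult_distrib sum_nonneg)
  finally show ?thesis by (simp add: s_def)
qed

lemma bessel_seq_summable:
  fixes x :: "'i \<Rightarrow> 'a::chilbert_space"
  assumes "bessel_seq J x B" "0 \<le> B" "(\<lambda>j. (cmod (c j))\<^sup>2) summable_on J"
  shows "(\<lambda>j. c j *\<^sub>C x j) summable_on J"
  by (rule summable_on_norm_sum_bound[OF assms(3) _ assms(2)])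
    (use bessel_seq_norm_sum_le[OF assms(1,2)] in auto)

lemma frame_bessel: "frame_with_bounds J x A B \<Longrightarrow> bessel_seq J x B"
  by (auto simp: bessel_seq_def frame_with_bounds_def)

lemma norm_infsum_le_bessel:
  fixes x :: "'i \<Rightarrow> 'a::chilbert_space"
  assumes x: "bessel_seq J x B" and B: "0 \<le> B"
    and c: "((\<lambda>j. (cmod (c j))\<^sup>2) has_sum S) J"
    and h: "((\<lambda>j. c j *\<^sub>C x j) has_sum h) J"
  shows "(norm h)\<^sup>2 \<le> B * S"
proof (rule tendsto_upperbound)
  show "((\<lambda>F. (norm (\<Sum>j\<in>F. c j *\<^sub>C x j))\<^sup>2) \<longlongrightarrow> (norm h)\<^sup>2) (finite_subsets_at_top J)"
    using h unfolding has_sum_def by (intro tendsto_intros)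
  show "\<forall>\<^sub>F F in finite_subsets_at_top J. (norm (\<Sum>j\<in>F. c j *\<^sub>C x j))\<^sup>2 \<le> B * S"
  proof (rule eventually_finite_subsets_at_top_weakI)
    fix F assume F: "finite F" "F \<subseteq> J"
    have "(\<Sum>j\<in>F. (cmod (c j))\<^sup>2) \<le> S" by (rule finite_sum_le_has_sum[OF c F]) simp
    then show "(norm (\<Sum>j\<in>F. c j *\<^sub>C x j))\<^sup>2 \<le> B * S"
      using bessel_seq_norm_sum_le[OF x B F, of c] B by (auto intro: order_trans mult_left_mono)
  qed
qed simp

section \<open>Boundedness and self-adjointness of the frame operator\<close>

text \<open>Separate from \<open>frame\<close>, because \<open>riesz_basis_is_frame\<close> uses
  continuity of the frame operator before a lower bound is known on the whole space.\<close>

locale bessel =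
  fixes J :: "'i set" and x :: "'i \<Rightarrow> 'a::chilbert_space" and B :: real
  assumes bessel: "bessel_seq J x B" and B_pos: "0 < B"
begin

abbreviation "S \<equiv> frame_op J x"

lemma coeff_summable: "(\<lambda>j. (cmod (cinner h (x j)))\<^sup>2) summable_on J"
  and coeff_le: "(\<Sum>\<^sub>\<infinity>j\<in>J. (cmod (cinner h (x j)))\<^sup>2) \<le> B * (norm h)\<^sup>2"
  using bessel by (auto simp: bessel_seq_def)

lemma frame_op_has_sum: "((\<lambda>j. cinner h (x j) *\<^sub>C x j) has_sum S h) J"
  unfolding frame_op_def
  using bessel_seq_summable[OF bessel _ coeff_summable] B_pos by (intro has_sum_infsum) simp

lemma frame_op_add: "S (h + k) = S h + S k"
  using has_sum_add[OF frame_op_has_sum[of h] frame_op_has_sum[of k]] frame_op_has_sum[of "h + k"]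
  by (auto simp: cinner_add_left scaleC_add_left intro: has_sum_unique)

lemma frame_op_scaleC: "S (c *\<^sub>C h) = c *\<^sub>C S h"
  using has_sum_bounded_linear[OF bounded_linear_scaleC_right frame_op_has_sum[of h], of c]
    frame_op_has_sum[of "c *\<^sub>C h"]
  by (auto intro: has_sum_unique)

text \<open>Analysis and synthesis contribute a factor \<open>sqrt B\<close> each.\<close>

lemma frame_op_norm_le: "norm (S h) \<le> B * norm h"
proof -
  have "(norm (S h))\<^sup>2 \<le> B * (\<Sum>\<^sub>\<infinity>j\<in>J. (cmod (cinner h (x j)))\<^sup>2)"
    using norm_infsum_le_bessel[OF bessel _ has_sum_infsum[OF coeff_summable] frame_op_has_sum] B_pos
    by simp
  also have "\<dots> \<le> B * (B * (norm h)\<^sup>2)" using coeff_le B_pos by simp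
  also have "\<dots> = (B * norm h)\<^sup>2" by (simp add: power2_eq_square)
  finally show ?thesis by (rule power2_le_imp_le) (use B_pos in simp)
qed

lemma frame_op_bounded_linear: "bounded_linear S"
  by (rule bounded_linear_intro[of _ B])
    (auto simp: frame_op_add scaleR_scaleC frame_op_scaleC frame_op_norm_le mult.commute)

lemma frame_op_cinner: "((\<lambda>j. cinner h (x j) * cinner (x j) k) has_sum cinner (S h) k) J"
  using has_sum_bounded_linear[OF bounded_linear_cinner_left frame_op_has_sum[of h], of k] by simp

lemma frame_op_selfadjoint: "cinner (S h) k = cinner h (S k)"
proof -
  have "((\<lambda>j. cnj (cinner k (x j) * cinner (x j) h)) has_sum cnj (cinner (S k) h)) J"
    using frame_op_cinner[of k h] by (simp only: has_sum_cnj_iff)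
  then have "((\<lambda>j. cinner h (x j) * cinner (x j) k) has_sum cinner h (S k)) J"
    by (simp add: mult.commute flip: cinner_commute)
  then show ?thesis using frame_op_cinner has_sum_unique by blast
qed

lemma frame_op_inner: "inner (S h) h = (\<Sum>\<^sub>\<infinity>j\<in>J. (cmod (cinner h (x j)))\<^sup>2)"
proof -
  have "cinner h (x j) * cinner (x j) h = complex_of_real ((cmod (cinner h (x j)))\<^sup>2)" for j
    by (metis cinner_commute complex_norm_square of_real_power)
  then have "((\<lambda>j. (cmod (cinner h (x j)))\<^sup>2) has_sum inner (S h) h) J"
    using has_sum_Re[OF frame_op_cinner[of h h]] by (simp add: inner_eq_Re_cinner)
  then show ?thesis by (simp add: infsumI)
qed

end

section \<open>Inversion of the frame operator\<close>

text \<open>The lower frame bound appears as coercivity of \<open>S\<close>;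
  \<open>frame_op_inner\<close> identifies it with the bound on the coefficient sum.\<close>

locale frame = bessel +
  fixes A :: real
  assumes A_pos: "0 < A" and lower: "A * (norm h)\<^sup>2 \<le> inner (S h) h"
begin

lemma frame_op_norm_ge: "A * norm h \<le> norm (S h)"
proof -
  have "norm h * (A * norm h) \<le> norm h * norm (S h)"
    using lower[of h] norm_cauchy_schwarz[of "S h" h] by (simp add: power2_eq_square ac_simps)
  then show ?thesis by (cases "h = 0") simp_all
qed

lemma frame_op_inj: "inj S"
proof (rule injI)
  fix h k assume "S h = S k"
  then have "S (h - k) = 0"
    using linear_diff[OF bounded_linear.linear[OF frame_op_bounded_linear]] by simp
  then show "h = k" using frame_op_norm_ge[of "h - k"] A_pos by (simp add: mult_le_0_iff)
qed

text \<open>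
  A solution of \<open>S h = y\<close> is a fixed point of \<open>h \<mapsto> h - \<tau> (S h - y)\<close>. Coercivity and boundedness
  of \<open>S\<close> make this map a contraction for \<open>\<tau> = A / C\<^sup>2\<close>; any \<open>C > A\<close> with \<open>C \<ge> B\<close> will do.
\<close>

lemma frame_op_surj: "surj S"
proof (rule surjI)
  fix y
  define C where "C = A + B"
  define \<tau> where "\<tau> = A / C\<^sup>2"
  \<comment> \<open>Coercivity and |S h| <= C |h| bound |h - \<tau> S h|^2 by (1 - 2 \<tau> A +
    \<tau>^2 C^2) |h|^2. The factor is least at \<tau> = A / C^2, where it equals 1 - (A /
    C)^2.\<close>
  define q where "q = sqrt (1 - (A / C)\<^sup>2)"
  have C: "0 < C" "A < C" "B \<le> C" using A_pos B_pos by (auto simp: C_def)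
  have "A\<^sup>2 < C\<^sup>2" using C A_pos by (intro power_strict_mono) auto
  then have AC2: "0 < (A / C)\<^sup>2" "(A / C)\<^sup>2 < 1" using C A_pos by (simp_all add: power_divide)
  have contr: "norm (h - \<tau> *\<^sub>R S h) \<le> q * norm h" for h
  proof -
    have "norm (S h) \<le> C * norm h"
      using frame_op_norm_le[of h] C mult_right_mono[of B C "norm h"] by simp
    then have "(norm (S h))\<^sup>2 \<le> (C * norm h)\<^sup>2" by (rule power_mono) simp
    then have "\<tau>\<^sup>2 * (norm (S h))\<^sup>2 \<le> \<tau>\<^sup>2 * (C * norm h)\<^sup>2" by (rule mult_left_mono) simp
    also have "\<dots> = (A / C)\<^sup>2 * (norm h)\<^sup>2"
      using C by (simp add: \<tau>_def field_simps power2_eq_square)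
    finally have 1: "\<tau>\<^sup>2 * (norm (S h))\<^sup>2 \<le> (A / C)\<^sup>2 * (norm h)\<^sup>2" .
    have "\<tau> * (A * (norm h)\<^sup>2) \<le> \<tau> * inner (S h) h"
      using lower A_pos by (intro mult_left_mono) (simp_all add: \<tau>_def)
    moreover have "\<tau> * (A * (norm h)\<^sup>2) = (A / C)\<^sup>2 * (norm h)\<^sup>2"
      by (simp add: \<tau>_def power2_eq_square)
    ultimately have 2: "(A / C)\<^sup>2 * (norm h)\<^sup>2 \<le> \<tau> * inner (S h) h" by simp
    have "(norm (h - \<tau> *\<^sub>R S h))\<^sup>2 = (norm h)\<^sup>2 - 2 * (\<tau> * inner (S h) h) + \<tau>\<^sup>2 * (norm (S h))\<^sup>2"
      unfolding power2_norm_eq_inner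
      by (simp add: inner_diff_left inner_diff_right inner_commute power2_eq_square)
    also have "\<dots> \<le> (1 - (A / C)\<^sup>2) * (norm h)\<^sup>2"
      using 1 2 by (simp add: left_diff_distrib)
    also have "\<dots> = (q * norm h)\<^sup>2"
      using AC2 by (simp add: q_def power_mult_distrib)
    finally show ?thesis
      by (rule power2_le_imp_le) (use AC2 in \<open>simp add: q_def\<close>)
  qed
  have "\<exists>!h. h - \<tau> *\<^sub>R (S h - y) = h"
  proof (rule banach_fix_type[of q])
    show "0 \<le> q" "q < 1" using AC2 by (simp_all add: q_def)
    show "\<forall>h k. dist (h - \<tau> *\<^sub>R (S h - y)) (k - \<tau> *\<^sub>R (S k - y)) \<le> q * dist h k"
    proof (intro allI)
      fix h k
      have "h - \<tau> *\<^sub>R (S h - y) - (k - \<tau> *\<^sub>R (S k - y)) = (h - k) - \<tau> *\<^sub>R S (h - k)"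
        by (simp add: linear_diff[OF bounded_linear.linear[OF frame_op_bounded_linear]]
            scaleR_diff_right)
      then show "dist (h - \<tau> *\<^sub>R (S h - y)) (k - \<tau> *\<^sub>R (S k - y)) \<le> q * dist h k"
        using contr[of "h - k"] by (simp only: dist_norm)
    qed
  qed
  then obtain h where "h - \<tau> *\<^sub>R (S h - y) = h" by blast
  then have "S h = y" using A_pos C by (simp add: \<tau>_def)
  then show "S (inv S y) = y" by (intro f_inv_into_f) blast
qed

lemma frame_op_inv: "S (inv S h) = h"
  by (rule surj_f_inv_f[OF frame_op_surj])

lemma frame_op_inv_norm: "norm h \<le> B * norm (inv S h)" "A * norm (inv S h) \<le> norm h"
  using frame_op_norm_le[of "inv S h"] frame_op_norm_ge[of "inv S h"] by (simp_all add: frame_op_inv)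

lemma frame_op_inv_bounded_linear: "bounded_linear (inv S)"
proof (rule bounded_linear_intro[of _ "1 / A"])
  have lin: "linear S" by (rule bounded_linear.linear[OF frame_op_bounded_linear])
  show "inv S (h + k) = inv S h + inv S k" for h k
    by (rule injD[OF frame_op_inj]) (simp add: frame_op_inv linear_add[OF lin])
  show "inv S (r *\<^sub>R h) = r *\<^sub>R inv S h" for r h
    by (rule injD[OF frame_op_inj]) (simp add: frame_op_inv linear_scale[OF lin])
  show "norm (inv S h) \<le> norm h * (1 / A)" for h
    using frame_op_inv_norm(2)[of h] A_pos by (simp add: field_simps)
qed

lemma frame_op_inv_scaleC: "inv S (c *\<^sub>C h) = c *\<^sub>C inv S h"
  by (rule injD[OF frame_op_inj]) (simp add: frame_op_inv frame_op_scaleC)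

section \<open>The canonical dual frame\<close>

text \<open>Self-adjointness moves \<open>inv S\<close> to the other slot. Coefficients against the
  dual thus become coefficients of \<open>inv S h\<close> against \<open>x\<close>, to which the
  known estimates apply.\<close>

lemma cinner_canonical_dual: "cinner h (canonical_dual J x j) = cinner (inv S h) (x j)"
  using frame_op_selfadjoint[of "inv S h" "inv S (x j)"]
  by (simp add: canonical_dual_def frame_op_inv)

text \<open>The first expansion is the series of \<open>S\<close> at \<open>inv S h\<close>; the
  second is the image under \<open>inv S\<close> of the series of \<open>S h\<close>.\<close>

lemma canonical_dual_reconstruct:
  "((\<lambda>j. cinner h (canonical_dual J x j) *\<^sub>C x j) has_sum h) J"
  "((\<lambda>j. cinner h (x j) *\<^sub>C canonical_dual J x j) has_sum h) J"
proof -
  show "((\<lambda>j. cinner h (canonical_dual J x j) *\<^sub>C x j) has_sum h) J"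
    using frame_op_has_sum[of "inv S h"] by (simp add: cinner_canonical_dual frame_op_inv)
  show "((\<lambda>j. cinner h (x j) *\<^sub>C canonical_dual J x j) has_sum h) J"
    using has_sum_bounded_linear[OF frame_op_inv_bounded_linear frame_op_has_sum[of h]]
    by (simp add: frame_op_inv_scaleC canonical_dual_def inv_f_f[OF frame_op_inj])
qed

lemma frame_with_bounds: "frame_with_bounds J x A B"
  unfolding frame_with_bounds_def
  using A_pos B_pos coeff_summable coeff_le lower by (simp add: frame_op_inner)

lemma canonical_dual_frame: "is_frame J (canonical_dual J x)"
proof -
  \<comment> \<open>The coefficient sum lies between \<open>A\<close> and \<open>B\<close> times the
    square of \<open>norm (inv S h)\<close>, and that norm lies between \<open>norm h / B\<close>
    and \<open>norm h / A\<close>. These bounds are cruder than 1 / B and 1 / A, but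
    \<open>is_frame\<close> asks only for existence.\<close>
  have "frame_with_bounds J (canonical_dual J x) (A / B\<^sup>2) (B / A\<^sup>2)"
    unfolding frame_with_bounds_def
  proof (intro conjI allI)
    fix h
    let ?s = "\<Sum>\<^sub>\<infinity>j\<in>J. (cmod (cinner h (canonical_dual J x j)))\<^sup>2"
    have s: "?s = inner (S (inv S h)) (inv S h)"
      by (simp add: cinner_canonical_dual frame_op_inner)
    show "(\<lambda>j. (cmod (cinner h (canonical_dual J x j)))\<^sup>2) summable_on J"
      by (simp add: cinner_canonical_dual coeff_summable)
    have "(norm h)\<^sup>2 \<le> (B * norm (inv S h))\<^sup>2"
      by (intro power_mono frame_op_inv_norm) simp
    then have "A / B\<^sup>2 * (norm h)\<^sup>2 \<le> A / B\<^sup>2 * (B * norm (inv S h))\<^sup>2"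
      using A_pos by (intro mult_left_mono) auto
    also have "\<dots> = A * (norm (inv S h))\<^sup>2" using B_pos by (simp add: field_simps)
    also have "\<dots> \<le> ?s" unfolding s by (rule lower)
    finally show "A / B\<^sup>2 * (norm h)\<^sup>2 \<le> ?s" .
    have "?s \<le> B * (norm (inv S h))\<^sup>2"
      unfolding s frame_op_inner by (rule coeff_le)
    also have "\<dots> = B / A\<^sup>2 * (A * norm (inv S h))\<^sup>2" using A_pos by (simp add: field_simps)
    also have "\<dots> \<le> B / A\<^sup>2 * (norm h)\<^sup>2"
      using A_pos B_pos by (intro mult_left_mono power_mono frame_op_inv_norm) auto
    finally show "?s \<le> B / A\<^sup>2 * (norm h)\<^sup>2" .
  qed (use A_pos B_pos in auto)
  then show ?thesis unfolding is_frame_def by blast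
qed

lemma canonical_dual_dual_frame: "dual_frame J x (canonical_dual J x)"
  unfolding dual_frame_def is_frame_def[of J x]
  using frame_with_bounds canonical_dual_frame canonical_dual_reconstruct by blast

end

lemma dual_frame_canonical_dual:
  assumes x: "frame_with_bounds J x A B"
  shows "dual_frame J x (canonical_dual J x)"
proof -
  interpret bessel J x B
    by unfold_locales (use x frame_bessel in \<open>auto simp: frame_with_bounds_def\<close>)
  interpret frame J x B A
    by unfold_locales (use x in \<open>auto simp: frame_op_inner frame_with_bounds_def\<close>)
  show ?thesis by (rule canonical_dual_dual_frame)
qed

section \<open>Dual frames and Riesz bases of tensor products\<close>

lemma cinner_eqI:
  fixes x y :: "'a::complex_inner"
  assumes "\<And>v. cinner x v = cinner y v"
  shows "x = y"
proof -
  have "cinner (x - y) (x - y) = 0" by (simp only: cinner_diff_left assms diff_self)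
  then show ?thesis by (simp add: cinner_self)
qed

text \<open>The two expansions run in opposite directions: \<open>f'\<close> analyses and
  \<open>f\<close> synthesises, while \<open>g\<close> analyses and \<open>g'\<close> synthesises,
  since T h is the sum of <h, g_k> T g'_k.\<close>

lemma tensor_family_reconstruct:
  fixes f f' :: "'i \<Rightarrow> 'b::chilbert_space" and g g' :: "'k \<Rightarrow> 'a::chilbert_space"
    and T :: "('a, 'b) hs_op"
  assumes F: "is_frame (I \<times> K) (tensor_family f g)" "is_frame (I \<times> K) (tensor_family f' g')"
    and f: "\<And>v. ((\<lambda>i. cinner v (f' i) *\<^sub>C f i) has_sum v) I"
    and g: "\<And>h. ((\<lambda>k. cinner h (g k) *\<^sub>C g' k) has_sum h) K"
  shows "((\<lambda>j. cinner T (tensor_family f' g' j) *\<^sub>C tensor_family f g j) has_sum T) (I \<times> K)"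
proof -
  obtain A B where fg: "frame_with_bounds (I \<times> K) (tensor_family f g) A B"
    using F(1) by (auto simp: is_frame_def)
  have "(\<lambda>j. (cmod (cinner T (tensor_family f' g' j)))\<^sup>2) summable_on I \<times> K"
    using F(2) by (auto simp: is_frame_def frame_with_bounds_def)
  then have "(\<lambda>j. cinner T (tensor_family f' g' j) *\<^sub>C tensor_family f g j) summable_on I \<times> K"
    using fg by (intro bessel_seq_summable[OF frame_bessel[OF fg]])
      (simp_all add: frame_with_bounds_def)
  \<comment> \<open>Convergence over \<open>I \<times> K\<close> comes first: a convergent double
    sum splits into iterated sums, but iterated sums alone would not give it.\<close>
  then obtain U where
    U: "((\<lambda>j. cinner T (tensor_family f' g' j) *\<^sub>C tensor_family f g j) has_sum U) (I \<times> K)"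
    by (auto simp: summable_on_def)
  have "cinner (hs_apply U h) v = cinner (hs_apply T h) v" for h v
  proof -
    have "((\<lambda>(i, k). cinner (hs_apply T (g' k)) (f' i) * (cinner h (g k) * cinner (f i) v))
        has_sum cinner (hs_apply U h) v) (I \<times> K)"
      using has_sum_bounded_linear[OF bounded_linear_cinner_left U, of "tensor_op v h"]
      by (simp add: tensor_family_def case_prod_unfold cinner_tensor_op hs_apply_tensor_op
          hs_apply_scaleC mult.assoc)
    then have "((\<lambda>(k, i). cinner (hs_apply T (g' k)) (f' i) * (cinner h (g k) * cinner (f i) v))
        has_sum cinner (hs_apply U h) v) (K \<times> I)"
      by (subst has_sum_swap) simp
    then have "((\<lambda>k. cinner h (g k) * cinner (hs_apply T (g' k)) v)
        has_sum cinner (hs_apply U h) v) K"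
    proof (rule has_sum_SigmaD)
      fix k
      have "((\<lambda>i. cinner (hs_apply T (g' k)) (f' i) * cinner (f i) v)
          has_sum cinner (hs_apply T (g' k)) v) I"
        using has_sum_bounded_linear[OF bounded_linear_cinner_left f[of "hs_apply T (g' k)"], of v]
        by simp
      from has_sum_cmult_right[OF this, of "cinner h (g k)"]
      show "((\<lambda>i. case (k, i) of (k, i) \<Rightarrow>
          cinner (hs_apply T (g' k)) (f' i) * (cinner h (g k) * cinner (f i) v))
          has_sum cinner h (g k) * cinner (hs_apply T (g' k)) v) I"
        by (simp add: mult.left_commute)
    qed
    moreover have "((\<lambda>k. cinner h (g k) * cinner (hs_apply T (g' k)) v)
        has_sum cinner (hs_apply T h) v) K"
    proof -
      have "bounded_linear (\<lambda>x. cinner (hs_apply T x) v)"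
        by (rule bounded_linear_compose[OF bounded_linear_cinner_left
              clinear_op_bounded[OF clinear_op_hs_apply]])
      from has_sum_bounded_linear[OF this g[of h]] show ?thesis
        by (simp add: clinear_op_scaleC[OF clinear_op_hs_apply])
    qed
    ultimately show ?thesis using has_sum_unique by blast
  qed
  then have "U = T" by (intro hs_op_eqI cinner_eqI)
  with U show ?thesis by simp
qed

lemma is_frame_tensor_family:
  "is_frame K g \<Longrightarrow> is_frame I f \<Longrightarrow> is_frame (I \<times> K) (tensor_family f g)"
  unfolding is_frame_def using frame_tensor_family by blast

lemma dual_frame_tensor_family:
  assumes "dual_frame K g g'" "dual_frame I f f'"
  shows "dual_frame (I \<times> K) (tensor_family f g) (tensor_family f' g')"
proof -
  have F: "is_frame (I \<times> K) (tensor_family f g)" "is_frame (I \<times> K) (tensor_family f' g')"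
    using assms by (simp_all add: dual_frame_def is_frame_tensor_family)
  show ?thesis
    using F assms tensor_family_reconstruct[OF F] tensor_family_reconstruct[OF F(2) F(1)]
    by (simp add: dual_frame_def)
qed

section \<open>Biorthogonal families\<close>

lemma biorthogonal_tensor_family:
  assumes "biorthogonal K g g'" "biorthogonal I f f'"
  shows "biorthogonal (I \<times> K) (tensor_family f g) (tensor_family f' g')"
proof -
  \<comment> \<open>The pairing of two rank-one operators factors as <g'_l, g_k> <f_i, f'_j>, with
    the \<open>g\<close> factor in reversed order.\<close>
  have "cinner (g' k) (g l) = cnj (cinner (g l) (g' k))" for k l
    by (rule cinner_commute)
  then show ?thesis
    using assms
    by (auto simp: biorthogonal_def tensor_family_def cinner_tensor_op hs_apply_tensor_op)
qed

text \<open>The difference of two candidates is orthogonal to a set with dense span, hence to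
  itself.\<close>

lemma biorthogonal_unique:
  assumes c: "closure (cspan (x ` J)) = UNIV"
    and w: "biorthogonal J x w" "biorthogonal J x y" and j: "j \<in> J"
  shows "w j = y j"
proof -
  have "cinner (w j - y j) e = 0" if "e \<in> x ` J" for e
  proof -
    have "cinner e (w j - y j) = 0"
      using that w j by (auto simp: biorthogonal_def cinner_diff_right)
    then show ?thesis using cinner_commute[of "w j - y j" e] by simp
  qed
  then have "cinner (w j - y j) (w j - y j) = 0"
    by (rule orthogonal_closure_span) (use c in auto)
  then show ?thesis by (simp add: cinner_self)
qed

section \<open>Riesz bases as frames with a biorthogonal dual\<close>

lemma riesz_basisE:
  assumes "riesz_basis J x"
  obtains A B where "A > 0" "B > 0"
    "\<And>F c. finite F \<Longrightarrow> F \<subseteq> J \<Longrightarrow>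
       A * (\<Sum>j\<in>F. (cmod (c j))\<^sup>2) \<le> (norm (\<Sum>j\<in>F. c j *\<^sub>C x j))\<^sup>2"
    "\<And>F c. finite F \<Longrightarrow> F \<subseteq> J \<Longrightarrow>
       (norm (\<Sum>j\<in>F. c j *\<^sub>C x j))\<^sup>2 \<le> B * (\<Sum>j\<in>F. (cmod (c j))\<^sup>2)"
proof -
  obtain A B where AB: "A > 0" "B > 0" and
    R: "\<forall>F c. finite F \<longrightarrow> F \<subseteq> J \<longrightarrow>
       A * (\<Sum>j\<in>F. (cmod (c j))\<^sup>2) \<le> (norm (\<Sum>j\<in>F. c j *\<^sub>C x j))\<^sup>2 \<and>
       (norm (\<Sum>j\<in>F. c j *\<^sub>C x j))\<^sup>2 \<le> B * (\<Sum>j\<in>F. (cmod (c j))\<^sup>2)"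
    using assms unfolding riesz_basis_def by (elim conjE exE) (rule that)
  show ?thesis
    by (rule that[OF AB R[rule_format, THEN conjunct1] R[rule_format, THEN conjunct2]])
qed

text \<open>The upper Riesz bound gives the Bessel bound by duality. The lower one gives coercivity
  of the frame operator on the span, and density extends it.\<close>

lemma riesz_basis_is_frame:
  fixes x :: "'i \<Rightarrow> 'a::chilbert_space"
  assumes "riesz_basis J x"
  shows "is_frame J x"
proof -
  have c: "closure (cspan (x ` J)) = UNIV" using assms by (simp add: riesz_basis_def)
  obtain A B where A: "A > 0" and B: "B > 0" and
    lo: "\<And>F c. finite F \<Longrightarrow> F \<subseteq> J \<Longrightarrow>
       A * (\<Sum>j\<in>F. (cmod (c j))\<^sup>2) \<le> (norm (\<Sum>j\<in>F. c j *\<^sub>C x j))\<^sup>2" and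
    up: "\<And>F c. finite F \<Longrightarrow> F \<subseteq> J \<Longrightarrow>
       (norm (\<Sum>j\<in>F. c j *\<^sub>C x j))\<^sup>2 \<le> B * (\<Sum>j\<in>F. (cmod (c j))\<^sup>2)"
    by (fact riesz_basisE[OF assms])
  \<comment> \<open>With coefficients <h, x_j>, the sum \<open>s\<close> of their squares is the
    pairing of the synthesised vector with \<open>h\<close>, so s^2 <= B s |h|^2 and one factor
    \<open>s\<close> cancels.\<close>
  have fin: "(\<Sum>j\<in>F. (cmod (cinner h (x j)))\<^sup>2) \<le> B * (norm h)\<^sup>2" if F: "finite F" "F \<subseteq> J" for F h
  proof -
    define s where "s = (\<Sum>j\<in>F. (cmod (cinner h (x j)))\<^sup>2)"
    have s0: "0 \<le> s" by (simp add: s_def sum_nonneg)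
    have "cinner (\<Sum>j\<in>F. cinner h (x j) *\<^sub>C x j) h = (\<Sum>j\<in>F. cinner h (x j) * cnj (cinner h (x j)))"
      by (simp add: cinner_sum_left flip: cinner_commute)
    also have "\<dots> = complex_of_real s"
      by (simp add: s_def complex_norm_square del: of_real_power)
    finally have "s = cmod (cinner (\<Sum>j\<in>F. cinner h (x j) *\<^sub>C x j) h)"
      using s0 by simp
    also have "\<dots> \<le> norm (\<Sum>j\<in>F. cinner h (x j) *\<^sub>C x j) * norm h"
      by (rule cinner_Cauchy_Schwarz)
    finally have "s\<^sup>2 \<le> (norm (\<Sum>j\<in>F. cinner h (x j) *\<^sub>C x j) * norm h)\<^sup>2"
      using s0 by (intro power_mono)
    also have "\<dots> \<le> (B * s) * (norm h)\<^sup>2"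
      unfolding power_mult_distrib using up[OF F, of "\<lambda>j. cinner h (x j)"]
      by (intro mult_right_mono) (simp_all add: s_def)
    finally have "s * s \<le> s * (B * (norm h)\<^sup>2)" by (simp add: power2_eq_square ac_simps)
    then show ?thesis using s0 B by (cases "s = 0") (simp_all flip: s_def)
  qed
  have "bessel_seq J x B"
    unfolding bessel_seq_def
  proof (intro allI conjI)
    fix h
    show sm: "(\<lambda>j. (cmod (cinner h (x j)))\<^sup>2) summable_on J"
      by (rule nonneg_bdd_above_summable_on) (use fin in \<open>auto intro!: bdd_aboveI2\<close>)
    show "(\<Sum>\<^sub>\<infinity>j\<in>J. (cmod (cinner h (x j)))\<^sup>2) \<le> B * (norm h)\<^sup>2"
      by (rule has_sum_le_finite_sums[OF has_sum_infsum[OF sm] fin])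
  qed
  then interpret bessel J x B using B by unfold_locales
  have dense: "A * (norm h)\<^sup>2 \<le> inner (S h) h" if h: "h \<in> cspan (x ` J)" for h
  proof -
    obtain t r where t: "finite t" "t \<subseteq> x ` J" "h = (\<Sum>a\<in>t. r a *\<^sub>C a)"
      using h unfolding cvec.span_explicit by blast
    \<comment> \<open>A span element comes as a combination of vectors; choosing one index for each
      vector turns it into a combination over indices, as the Riesz bounds require.\<close>
    obtain F where F: "finite F" "F \<subseteq> J" and inj: "inj_on x F" and tF: "t = x ` F"
      using t(1,2) by (metis finite_image_iff subset_image_inj)
    define d where "d j = r (x j)" for j
    have hd: "h = (\<Sum>j\<in>F. d j *\<^sub>C x j)"
      unfolding t(3) tF d_def by (simp add: sum.reindex[OF inj])
    let ?d = "\<Sum>j\<in>F. (cmod (d j))\<^sup>2" and ?s = "\<Sum>j\<in>F. (cmod (cinner h (x j)))\<^sup>2"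
    have "cinner h h = (\<Sum>j\<in>F. d j * cinner (x j) h)"
      by (subst (1) hd) (simp add: cinner_sum_left)
    then have "(norm h)\<^sup>2 = cmod (\<Sum>j\<in>F. d j * cinner (x j) h)"
      by (metis abs_of_nonneg cinner_self norm_of_real zero_le_power2)
    also have "\<dots> \<le> sqrt ?d * sqrt ?s"
      using cmod_sum_mult_le_L2[of d "\<lambda>j. cinner (x j) h" F] by (simp add: cmod_cinner_commute[of h])
    finally have "((norm h)\<^sup>2)\<^sup>2 \<le> (sqrt ?d * sqrt ?s)\<^sup>2" by (rule power_mono) simp
    \<comment> \<open>The lower Riesz bound replaces \<open>A * ?d\<close> by at most |h|^2, after
      which a factor |h|^2 cancels.\<close>
    then have "(norm h)\<^sup>2 * (norm h)\<^sup>2 \<le> ?d * ?s"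
      by (simp only: power_mult_distrib power2_eq_square[of "(norm h)\<^sup>2"] real_sqrt_pow2
          sum_nonneg zero_le_power2)
    then have "A * ((norm h)\<^sup>2 * (norm h)\<^sup>2) \<le> A * (?d * ?s)"
      using A by (intro mult_left_mono) auto
    also have "\<dots> \<le> (norm h)\<^sup>2 * ?s"
      using mult_right_mono[OF lo[OF F, of d], of ?s] by (simp add: hd[symmetric] sum_nonneg ac_simps)
    finally have "(norm h)\<^sup>2 * (A * (norm h)\<^sup>2) \<le> (norm h)\<^sup>2 * ?s" by (simp add: ac_simps)
    then have "A * (norm h)\<^sup>2 \<le> ?s"
      by (cases "h = 0") (simp_all add: mult_le_cancel_left_pos)
    also have "\<dots> \<le> inner (S h) h"
      unfolding frame_op_inner by (rule finite_sum_le_infsum[OF coeff_summable F]) simp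
    finally show ?thesis .
  qed
  \<comment> \<open>Continuity of \<open>S\<close> makes the coercivity inequality a closed
    condition, so it passes from the span to its closure.\<close>
  have "closed {h. A * (norm h)\<^sup>2 \<le> inner (S h) h}"
    by (intro closed_Collect_le continuous_intros linear_continuous_on frame_op_bounded_linear)
  then have "A * (norm h)\<^sup>2 \<le> inner (S h) h" for h
    using dense c closure_minimal[of "cspan (x ` J)" "{h. A * (norm h)\<^sup>2 \<le> inner (S h) h}"] by blast
  then interpret frame J x B A using A by unfold_locales
  show ?thesis unfolding is_frame_def using frame_with_bounds by blast
qed

lemma riesz_basis_canonical_dual: "riesz_basis J x \<Longrightarrow> dual_frame J x (canonical_dual J x)"
  using riesz_basis_is_frame dual_frame_canonical_dual unfolding is_frame_def by blast

text \<open>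
  Both \<open>x k\<close> and its reconstruction from the dual frame are expansions in \<open>x\<close>; the lower Riesz
  bound forces their coefficients to agree.
\<close>

lemma riesz_basis_dual_frame_biorthogonal:
  fixes x y :: "'i \<Rightarrow> 'a::chilbert_space"
  assumes R: "riesz_basis J x" and D: "dual_frame J x y"
  shows "biorthogonal J x y"
  unfolding biorthogonal_def
proof (intro ballI)
  fix k l assume k: "k \<in> J" and l: "l \<in> J"
  obtain A B where A: "A > 0" and "B > 0" and
    lo: "\<And>F c. finite F \<Longrightarrow> F \<subseteq> J \<Longrightarrow>
       A * (\<Sum>j\<in>F. (cmod (c j))\<^sup>2) \<le> (norm (\<Sum>j\<in>F. c j *\<^sub>C x j))\<^sup>2" and
    "\<And>F c. finite F \<Longrightarrow> F \<subseteq> J \<Longrightarrow>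
       (norm (\<Sum>j\<in>F. c j *\<^sub>C x j))\<^sup>2 \<le> B * (\<Sum>j\<in>F. (cmod (c j))\<^sup>2)"
    by (fact riesz_basisE[OF R])
  define d where "d j = cinner (x k) (y j) - (if j = k then 1 else 0)" for j
  have "((\<lambda>j. (if j = k then 1 else 0) *\<^sub>C x j) has_sum x k) J"
    by (rule has_sum_finite_neutralI[of "{k}"]) (use k in auto)
  then have "((\<lambda>j. - ((if j = k then 1 else 0) *\<^sub>C x j)) has_sum - x k) J"
    by (simp only: has_sum_uminus minus_minus)
  moreover have "((\<lambda>j. cinner (x k) (y j) *\<^sub>C x j) has_sum x k) J"
    using D by (simp add: dual_frame_def)
  ultimately have "((\<lambda>j. d j *\<^sub>C x j) has_sum x k - x k) J"
    unfolding d_def cvec.scale_left_diff_distrib by (subst (1 2) diff_conv_add_uminus) (rule has_sum_add)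
  then have "((\<lambda>F. (norm (\<Sum>j\<in>F. d j *\<^sub>C x j))\<^sup>2) \<longlongrightarrow> (norm (x k - x k))\<^sup>2) (finite_subsets_at_top J)"
    unfolding has_sum_def by (intro tendsto_intros)
  \<comment> \<open>Once a finite set contains \<open>l\<close>, the lower Riesz bound keeps the
    squared norm of its partial sum above \<open>A\<close> times |d_l|^2, while these squared norms
    tend to 0.\<close>
  moreover have "\<forall>\<^sub>F F in finite_subsets_at_top J. A * (cmod (d l))\<^sup>2 \<le> (norm (\<Sum>j\<in>F. d j *\<^sub>C x j))\<^sup>2"
    unfolding eventually_finite_subsets_at_top
  proof (intro exI[of _ "{l}"] conjI allI impI)
    fix F assume F: "finite F \<and> {l} \<subseteq> F \<and> F \<subseteq> J"
    have "(cmod (d l))\<^sup>2 \<le> (\<Sum>j\<in>F. (cmod (d j))\<^sup>2)"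
      using F by (intro member_le_sum[of l F "\<lambda>j. (cmod (d j))\<^sup>2"]) auto
    then have "A * (cmod (d l))\<^sup>2 \<le> A * (\<Sum>j\<in>F. (cmod (d j))\<^sup>2)" using A by simp
    also have "\<dots> \<le> (norm (\<Sum>j\<in>F. d j *\<^sub>C x j))\<^sup>2" using F by (intro lo) auto
    finally show "A * (cmod (d l))\<^sup>2 \<le> (norm (\<Sum>j\<in>F. d j *\<^sub>C x j))\<^sup>2" .
  qed (use l in auto)
  ultimately have "A * (cmod (d l))\<^sup>2 \<le> (norm (x k - x k))\<^sup>2"
    by (rule tendsto_lowerbound) simp
  then have "d l = 0" using A by (simp add: mult_le_0_iff)
  then show "cinner (x k) (y l) = (if k = l then 1 else 0)" by (auto simp: d_def)
qed

text \<open>Biorthogonality identifies the coefficients of a finite sum as its frame coefficients with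
  respect to \<open>y\<close>, so the lower Riesz bound is the Bessel bound of \<open>y\<close>.\<close>

lemma dual_frame_biorthogonal_riesz_basis:
  fixes x y :: "'i \<Rightarrow> 'a::chilbert_space"
  assumes D: "dual_frame J x y" and bi: "biorthogonal J x y"
  shows "riesz_basis J x"
proof -
  obtain A B A' B' where x: "frame_with_bounds J x A B" and y: "frame_with_bounds J y A' B'"
    using D by (auto simp: dual_frame_def is_frame_def)
  have B: "0 < B" "0 < B'" using x y by (auto simp: frame_with_bounds_def)
  have "h \<in> closure (cspan (x ` J))" for h
  proof (rule Lim_in_closed_set)
    show "((\<lambda>F. \<Sum>j\<in>F. cinner h (y j) *\<^sub>C x j) \<longlongrightarrow> h) (finite_subsets_at_top J)"
      using D by (simp add: dual_frame_def has_sum_def)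
    show "\<forall>\<^sub>F F in finite_subsets_at_top J. (\<Sum>j\<in>F. cinner h (y j) *\<^sub>C x j) \<in> closure (cspan (x ` J))"
      by (rule eventually_finite_subsets_at_top_weakI)
        (intro closure_subset[THEN subsetD] cvec.span_sum cvec.span_scale cvec.span_base, blast)
  qed auto
  moreover have "1 / B' * (\<Sum>j\<in>F. (cmod (c j))\<^sup>2) \<le> (norm (\<Sum>j\<in>F. c j *\<^sub>C x j))\<^sup>2"
    if F: "finite F" "F \<subseteq> J" for F c
  proof -
    have "cinner (\<Sum>j\<in>F. c j *\<^sub>C x j) (y l) = c l" if l: "l \<in> F" for l
    proof -
      have "cinner (\<Sum>j\<in>F. c j *\<^sub>C x j) (y l) = (\<Sum>j\<in>F. if j = l then c j else 0)"
        unfolding cinner_sum_left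
        by (intro sum.cong) (use bi F l in \<open>auto simp: biorthogonal_def subset_iff\<close>)
      then show ?thesis using F l by simp
    qed
    then have "(\<Sum>j\<in>F. (cmod (c j))\<^sup>2) \<le> B' * (norm (\<Sum>j\<in>F. c j *\<^sub>C x j))\<^sup>2"
      using bessel_seq_finite_sum_le[OF frame_bessel[OF y] F, of "\<Sum>j\<in>F. c j *\<^sub>C x j"] by simp
    then show ?thesis using B by (simp add: field_simps)
  qed
  moreover have "(norm (\<Sum>j\<in>F. c j *\<^sub>C x j))\<^sup>2 \<le> B * (\<Sum>j\<in>F. (cmod (c j))\<^sup>2)"
    if "finite F" "F \<subseteq> J" for F c
    using bessel_seq_norm_sum_le[OF frame_bessel[OF x] _ that] B by simp
  ultimately show ?thesis
    unfolding riesz_basis_def using B by (intro conjI exI[of _ "1 / B'"] exI[of _ B]) auto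
qed

section \<open>Bessel sequences, frames and Riesz bases of tensor products\<close>

theorem theorem4p1:
  fixes g :: "'k \<Rightarrow> 'a::chilbert_space" and f :: "'i \<Rightarrow> 'b::chilbert_space"
    and K :: "'k set" and I :: "'i set"
  assumes "infinite_dim TYPE('a)" and "separable_space (euclidean :: 'a topology)"
    and "infinite_dim TYPE('b)" and "separable_space (euclidean :: 'b topology)"
    and "countable K" and "countable I"
  shows "(\<forall>B B'. bessel_seq K g B \<and> bessel_seq I f B' \<longrightarrow>
            bessel_seq (I \<times> K) (tensor_family f g) (B * B')) \<and>
         (\<forall>A B A' B'. frame_with_bounds K g A B \<and> frame_with_bounds I f A' B' \<longrightarrow>
            frame_with_bounds (I \<times> K) (tensor_family f g) (A * A') (B * B') \<and>
            dual_frame (I \<times> K) (tensor_family f g)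
              (tensor_family (canonical_dual I f) (canonical_dual K g))) \<and>
         (riesz_basis K g \<and> riesz_basis I f \<longrightarrow>
            riesz_basis (I \<times> K) (tensor_family f g) \<and>
            biorthogonal I f (canonical_dual I f) \<and> biorthogonal K g (canonical_dual K g) \<and>
            (\<forall>f' g'. biorthogonal I f f' \<and> biorthogonal K g g' \<longrightarrow>
               (\<forall>w. biorthogonal (I \<times> K) (tensor_family f g) w \<longleftrightarrow>
                  (\<forall>j\<in>I \<times> K. w j = tensor_family f' g' j))))"
proof (intro conjI allI impI)
  fix B B' assume H: "bessel_seq K g B \<and> bessel_seq I f B'"
  have "0 \<le> B'" using H bessel_bound_nonneg assms(3) by blast
  then show "bessel_seq (I \<times> K) (tensor_family f g) (B * B')"
    using H analysis_bounds_tensor_family[of K g 0 B I f 0 B'] by (simp add: bessel_iff_analysis_bounds)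
next
  fix A B A' B' assume H: "frame_with_bounds K g A B \<and> frame_with_bounds I f A' B'"
  show "frame_with_bounds (I \<times> K) (tensor_family f g) (A * A') (B * B')"
    using H frame_tensor_family by blast
  show "dual_frame (I \<times> K) (tensor_family f g)
      (tensor_family (canonical_dual I f) (canonical_dual K g))"
    by (rule dual_frame_tensor_family[OF dual_frame_canonical_dual dual_frame_canonical_dual])
      (use H in blast)+
next
  assume H: "riesz_basis K g \<and> riesz_basis I f"
  then have D: "dual_frame K g (canonical_dual K g)" "dual_frame I f (canonical_dual I f)"
    by (simp_all add: riesz_basis_canonical_dual)
  show bi: "biorthogonal I f (canonical_dual I f)" "biorthogonal K g (canonical_dual K g)"
    using H D by (simp_all add: riesz_basis_dual_frame_biorthogonal)
  \<comment> \<open>The canonical duals tensor to a dual frame that is also biorthogonal, which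
    characterises a Riesz basis without estimating sums of rank-one operators directly.\<close>
  show R: "riesz_basis (I \<times> K) (tensor_family f g)"
    using dual_frame_biorthogonal_riesz_basis dual_frame_tensor_family[OF D]
      biorthogonal_tensor_family[OF bi(2,1)] by blast
  fix f' g' w assume b: "biorthogonal I f f' \<and> biorthogonal K g g'"
  have t: "biorthogonal (I \<times> K) (tensor_family f g) (tensor_family f' g')"
    using b biorthogonal_tensor_family by blast
  show "biorthogonal (I \<times> K) (tensor_family f g) w \<longleftrightarrow>
      (\<forall>j\<in>I \<times> K. w j = tensor_family f' g' j)"
  proof
    assume "biorthogonal (I \<times> K) (tensor_family f g) w"
    \<comment> \<open>Completeness of the tensor family, part of \<open>R\<close>, makes its
      biorthogonal family unique on the index set.\<close>
    then show "\<forall>j\<in>I \<times> K. w j = tensor_family f' g' j"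
      using biorthogonal_unique[OF _ _ t] R by (simp add: riesz_basis_def)
  next
    assume "\<forall>j\<in>I \<times> K. w j = tensor_family f' g' j"
    then show "biorthogonal (I \<times> K) (tensor_family f g) w"
      using t unfolding biorthogonal_def by simp
  qed
qed

end
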